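(* Let $p$ be a prime. There does not exist an even spectral triple $$\left(\mathcal{O}(\mathbb{Z}_p),\ \pi\oplus\pi,\ \begin{pmatrix}0 & D \\ D^* & 0\end{pmatrix},\ \begin{pmatrix}1 & 0 \\ 0 & -1\end{pmatrix}\right)$$ of $C(\mathbb{Z}_p)$, where $\pi$ is the GNS representation of $\mathcal{O}(\mathbb{Z}_p)$ on $L^2(\mathbb{Z}_p)$, and $D$ is an injective operator with $\mathrm{Index}(D)\ne0$ satisfying $$D(\chi_n)=\lambda_n\chi_{\phi(n)},\quad \lambda_n\in\mathbb{C},\ n\in\mathbb{N}_0,$$ for some function $\phi:\mathbb{N}_0\to\mathbb{N}_0$.
   Context: $\mathbb{Z}_p$ is the compact additive group of $p$-adic integers; $\mathcal{O}(\mathbb{Z}_p)\subset C(\mathbb{Z}_p)$ is the linear span of its continuous characters. The GNS representation $\pi$ is with respect to the Haar state: $\pi(f)$ is multiplication by $f$ on $L^2(\mathbb{Z}_p)$. An even spectral triple of this form is on $L^2(\mathbb{Z}_p)\oplus L^2(\mathbb{Z}_p)$, graded by the last matrix: the Dirac operator $\begin{pmatrix}0 & D \\ D^* & 0\end{pmatrix}$ is self-adjoint with compact resolvent and has bounded commutators with $(\pi\oplus\pi)(f)$, $f\in\mathcal{O}(\mathbb{Z}_p)$. $\mathrm{Index}(D)$ is the Fredholm index. The Monna map $T:\mathbb{Z}_p\to[0,1]$ is $T(\sum_{k=0}^\infty x_kp^k)=\sum_{k=0}^\infty x_kp^{-(k+1)}$, $0\le x_k\le p-1$. For $n\in\mathbb{N}_0$,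 $\chi_n:\mathbb{Z}_p\to\mathbb{T}$ is the continuous character with $\chi_n(1)=e^{2\pi iT(n)}$; then $\widehat{\mathbb{Z}_p}=\{\chi_n:n\in\mathbb{N}_0\}$. *)

theory Defs
  imports "HOL-Probability.Probability" "Berlekamp_Zassenhaus.Finite_Field"
begin

section \<open>The compact group of \<open>p\<close>-adic integers\<close>

text \<open>
  The prime is \<open>p = CARD('p)\<close> for a type \<open>'p\<close> of prime cardinality, and the \<open>p\<close>-adic integers are
  the inverse limit of the rings \<open>\<int>/p^n\<int>\<close>: \<open>residue x n\<close> is the residue of \<open>x\<close> in \<open>{0..<p^n}\<close>.
\<close>

abbreviation prm :: "'p::prime_card itself \<Rightarrow> int" where
  "prm _ \<equiv> int CARD('p)"

lemma prm_gt_1: "prm TYPE('p::prime_card) > 1"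
  using prime_card[where 'a='p] prime_gt_1_nat by auto

lemma prm_pos [simp]: "prm TYPE('p::prime_card) > 0" "prm TYPE('p::prime_card) ^ n > 0"
  using prm_gt_1[where 'p='p] by auto

typedef (overloaded) ('p::prime_card) padic_int =
  "{x :: nat \<Rightarrow> int. \<forall>n. x n \<in> {0..<prm TYPE('p) ^ n} \<and> x (Suc n) mod prm TYPE('p) ^ n = x n}"
  morphisms residue Abs_padic_int
  by (rule exI[of _ "\<lambda>_. 0"]) simp

setup_lifting type_definition_padic_int

lemma mod_power_Suc: "(a::int) mod b ^ Suc n mod b ^ n = a mod b ^ n"
  by (simp add: mod_mod_cancel)

lemma residue_bounds: "0 \<le> residue (x::'p::prime_card padic_int) n" "residue x n < prm TYPE('p) ^ n"
  using residue[of x] by auto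

lemma residue_Suc_mod: "residue (x::'p::prime_card padic_int) (Suc n) mod prm TYPE('p) ^ n = residue x n"
  using residue[of x] by auto

lemma residue_mod [simp]: "residue (x::'p::prime_card padic_int) n mod prm TYPE('p) ^ n = residue x n"
  using residue_bounds[of x n] by auto

lemma mod_step:
  fixes a b P :: int
  assumes "a mod P = a'" "b mod P = b'"
  shows "(a + b) mod P = (a' + b') mod P" "(a - b) mod P = (a' - b') mod P"
    "(a * b) mod P = (a' * b') mod P" "(- a) mod P = (- a') mod P"
  unfolding assms[symmetric] by (simp_all add: mod_simps)

instantiation padic_int :: (prime_card) comm_ring_1
begin

lift_definition zero_padic_int :: "'a padic_int" is "\<lambda>_. 0" by simp

lift_definition one_padic_int :: "'a padic_int" is "\<lambda>n. 1 mod prm TYPE('a) ^ n"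
  by (simp add: mod_power_Suc del: power_Suc)

lift_definition plus_padic_int :: "'a padic_int \<Rightarrow> 'a padic_int \<Rightarrow> 'a padic_int"
  is "\<lambda>x y n. (x n + y n) mod prm TYPE('a) ^ n"
  by (auto simp: mod_power_Suc simp del: power_Suc intro: mod_step)

lift_definition minus_padic_int :: "'a padic_int \<Rightarrow> 'a padic_int \<Rightarrow> 'a padic_int"
  is "\<lambda>x y n. (x n - y n) mod prm TYPE('a) ^ n"
  by (auto simp: mod_power_Suc simp del: power_Suc intro: mod_step)

lift_definition uminus_padic_int :: "'a padic_int \<Rightarrow> 'a padic_int"
  is "\<lambda>x n. (- x n) mod prm TYPE('a) ^ n"
  by (auto simp: mod_power_Suc simp del: power_Suc intro: mod_step)

lift_definition times_padic_int :: "'a padic_int \<Rightarrow> 'a padic_int \<Rightarrow> 'a padic_int"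
  is "\<lambda>x y n. (x n * y n) mod prm TYPE('a) ^ n"
  by (auto simp: mod_power_Suc simp del: power_Suc intro: mod_step)

instance
proof
  fix a b c :: "'a padic_int"
  show "a + b + c = a + (b + c)" by transfer (auto simp: mod_simps algebra_simps)
  show "a + b = b + a" by transfer (auto simp: algebra_simps)
  show "0 + a = a" by transfer (auto simp: fun_eq_iff)
  show "- a + a = 0" by transfer (auto simp: mod_simps)
  show "a - b = a + - b" by transfer (auto simp: mod_simps)
  show "a * b * c = a * (b * c)" by transfer (auto simp: mod_simps algebra_simps)
  show "a * b = b * a" by transfer (auto simp: algebra_simps)
  show "1 * a = a" by transfer (auto simp: fun_eq_iff mod_simps)
  show "(a + b) * c = a * c + b * c" by transfer (auto simp: mod_simps algebra_simps)
  show "(0 :: 'a padic_int) \<noteq> 1"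
  proof transfer
    have "1 mod prm TYPE('a) ^ 1 = 1" using prm_gt_1[where 'p='a] by simp
    then show "(\<lambda>_. 0) \<noteq> (\<lambda>n. 1 mod prm TYPE('a) ^ n)"
      by (metis zero_neq_one)
  qed
qed

end

lemma residue_le_mod:
  "m \<le> n \<Longrightarrow> residue (x::'p::prime_card padic_int) n mod prm TYPE('p) ^ m = residue x m"
proof (induction n rule: dec_induct)
  case (step n)
  have "residue x (Suc n) mod prm TYPE('p) ^ m = residue x (Suc n) mod prm TYPE('p) ^ n mod prm TYPE('p) ^ m"
    using step by (simp add: mod_mod_cancel le_imp_power_dvd)
  then show ?case using step by (simp add: residue_Suc_mod)
qed simp

lemma residue_eq_le:
  "m \<le> n \<Longrightarrow> residue (x::'p::prime_card padic_int) n = residue (y::'p padic_int) n \<Longrightarrow> residue x m = residue y m"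
  using residue_le_mod[of m n x] residue_le_mod[of m n y] by simp

instantiation padic_int :: (prime_card) topological_space
begin

text \<open>The \<open>p\<close>-adic topology: the cosets \<open>x + p^n \<int>\<^sub>p = {y. residue y n = residue x n}\<close> are a
  neighbourhood basis of \<open>x\<close>.\<close>

definition open_padic_int :: "'a padic_int set \<Rightarrow> bool" where
  "open_padic_int U \<longleftrightarrow> (\<forall>x\<in>U. \<exists>n. \<forall>y. residue y n = residue x n \<longrightarrow> y \<in> U)"

instance
proof
  show "open (UNIV :: 'a padic_int set)" by (simp add: open_padic_int_def)
next
  fix S T :: "'a padic_int set"
  assume S: "open S" and T: "open T"
  show "open (S \<inter> T)"
    unfolding open_padic_int_def
  proof
    fix x assume x: "x \<in> S \<inter> T"
    obtain m where m: "\<forall>y. residue y m = residue x m \<longrightarrow> y \<in> S"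
      using S x by (auto simp: open_padic_int_def)
    obtain n where n: "\<forall>y. residue y n = residue x n \<longrightarrow> y \<in> T"
      using T x by (auto simp: open_padic_int_def)
    have "\<forall>y. residue y (max m n) = residue x (max m n) \<longrightarrow> y \<in> S \<inter> T"
      using m n by (metis IntI residue_eq_le max.cobounded1 max.cobounded2)
    then show "\<exists>n. \<forall>y. residue y n = residue x n \<longrightarrow> y \<in> S \<inter> T" by blast
  qed
next
  fix K :: "'a padic_int set set"
  assume "\<forall>S\<in>K. open S"
  then show "open (\<Union>K)" unfolding open_padic_int_def by (metis Union_iff)
qed

end

definition digit :: "'p::prime_card padic_int \<Rightarrow> nat \<Rightarrow> int" where
  "digit x k = residue x (Suc k) div prm TYPE('p) ^ k"

definition monna :: "'p::prime_card padic_int \<Rightarrow> real" where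
  "monna x = (\<Sum>k. of_int (digit x k) / of_nat CARD('p) ^ (k + 1))"

definition continuous_character :: "('p::prime_card padic_int \<Rightarrow> complex) \<Rightarrow> bool" where
  "continuous_character \<psi> \<longleftrightarrow>
     continuous_on UNIV \<psi> \<and> (\<forall>x. norm (\<psi> x) = 1) \<and> (\<forall>x y. \<psi> (x + y) = \<psi> x * \<psi> y)"

definition chi :: "nat \<Rightarrow> 'p::prime_card padic_int \<Rightarrow> complex" where
  "chi n = (THE \<psi>. continuous_character \<psi> \<and>
      \<psi> 1 = exp (2 * of_real pi * \<i> * of_real (monna (of_nat n :: 'p padic_int))))"

definition trig_poly :: "('p::prime_card padic_int \<Rightarrow> complex) set" where
  "trig_poly = {f. \<exists>F c. finite F \<and> (\<forall>\<psi>\<in>F. continuous_character \<psi>) \<and> f = (\<lambda>x. \<Sum>\<psi>\<in>F. c \<psi> * \<psi> x)}"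

definition is_haar :: "'p::prime_card padic_int measure \<Rightarrow> bool" where
  "is_haar \<mu> \<longleftrightarrow> sets \<mu> = sets borel \<and> prob_space \<mu> \<and> (\<forall>a. distr \<mu> borel (\<lambda>x. a + x) = \<mu>)"

definition haar :: "'p::prime_card padic_int measure" where
  "haar = (THE \<mu>. is_haar \<mu>)"


section \<open>Complex inner product spaces\<close>

text \<open>The topology is the one of the underlying real inner product space; the complex inner product
  is linear in the first argument.\<close>

class complex_inner = real_inner +
  fixes scaleC :: "complex \<Rightarrow> 'a \<Rightarrow> 'a" (infixr \<open>*\<^sub>C\<close> 75)
    and cinner :: "'a \<Rightarrow> 'a \<Rightarrow> complex"
  assumes scaleC_add_right: "c *\<^sub>C (x + y) = c *\<^sub>C x + c *\<^sub>C y"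
    and scaleC_add_left: "(b + c) *\<^sub>C x = b *\<^sub>C x + c *\<^sub>C x"
    and scaleC_scaleC: "b *\<^sub>C c *\<^sub>C x = (b * c) *\<^sub>C x"
    and scaleC_of_real: "complex_of_real r *\<^sub>C x = r *\<^sub>R x"
    and cinner_commute: "cinner x y = cnj (cinner y x)"
    and cinner_add_left: "cinner (x + y) z = cinner x z + cinner y z"
    and cinner_scaleC_left: "cinner (c *\<^sub>C x) y = c * cinner x y"
    and Re_cinner: "Re (cinner x y) = inner x y"

lemma scaleC_one: "1 *\<^sub>C x = (x :: 'a::complex_inner)"
  using scaleC_of_real[of 1 x] by simp

global_interpretation complex_vector: vector_space "scaleC :: complex \<Rightarrow> 'a \<Rightarrow> 'a::complex_inner"
  by unfold_locales (simp_all add: scaleC_add_right scaleC_add_left scaleC_scaleC scaleC_one)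

instantiation prod :: (complex_inner, complex_inner) complex_inner
begin

definition scaleC_prod :: "complex \<Rightarrow> 'a \<times> 'b \<Rightarrow> 'a \<times> 'b" where
  "scaleC_prod c x = (c *\<^sub>C fst x, c *\<^sub>C snd x)"

definition cinner_prod :: "'a \<times> 'b \<Rightarrow> 'a \<times> 'b \<Rightarrow> complex" where
  "cinner_prod x y = cinner (fst x) (fst y) + cinner (snd x) (snd y)"

instance
proof
  fix x y z :: "'a \<times> 'b" and b c :: complex and r :: real
  show "c *\<^sub>C (x + y) = c *\<^sub>C x + c *\<^sub>C y" "(b + c) *\<^sub>C x = b *\<^sub>C x + c *\<^sub>C x"
    "b *\<^sub>C c *\<^sub>C x = (b * c) *\<^sub>C x" "complex_of_real r *\<^sub>C x = r *\<^sub>R x"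
    by (auto simp: scaleC_prod_def prod_eq_iff scaleC_add_right scaleC_add_left scaleC_scaleC scaleC_of_real)
  show "cinner x y = cnj (cinner y x)"
    unfolding cinner_prod_def using cinner_commute by (metis complex_cnj_add)
  show "cinner (x + y) z = cinner x z + cinner y z" "cinner (c *\<^sub>C x) y = c * cinner x y"
    by (auto simp: cinner_prod_def scaleC_prod_def cinner_add_left cinner_scaleC_left algebra_simps)
  show "Re (cinner x y) = inner x y"
    by (simp add: cinner_prod_def inner_prod_def Re_cinner)
qed

end

definition bounded_clinear :: "('a::complex_inner \<Rightarrow> 'b::complex_inner) \<Rightarrow> bool" where
  "bounded_clinear A \<longleftrightarrow> bounded_linear A \<and> (\<forall>c x. A (c *\<^sub>C x) = c *\<^sub>C A x)"

definition compact_operator :: "('a::complex_inner \<Rightarrow> 'b::complex_inner) \<Rightarrow> bool" where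
  "compact_operator A \<longleftrightarrow> bounded_clinear A \<and> compact (closure (A ` cball 0 1))"

definition finite_dim :: "'a::complex_inner set \<Rightarrow> bool" where
  "finite_dim S \<longleftrightarrow> (\<exists>B. finite B \<and> S \<subseteq> complex_vector.span B)"


section \<open>Unbounded operators\<close>

text \<open>An unbounded operator is represented by its graph, a set of pairs \<open>(x, T x)\<close>; its domain and
  range are \<^const>\<open>Domain\<close> and \<^const>\<open>Range\<close>.\<close>

definition is_operator :: "('a::complex_inner \<times> 'b::complex_inner) set \<Rightarrow> bool" where
  "is_operator T \<longleftrightarrow> complex_vector.subspace T \<and> single_valued T"

definition densely_defined :: "('a::complex_inner \<times> 'b::complex_inner) set \<Rightarrow> bool" where
  "densely_defined T \<longleftrightarrow> closure (Domain T) = UNIV"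

definition adjoint :: "('a::complex_inner \<times> 'b::complex_inner) set \<Rightarrow> ('b \<times> 'a) set" where
  "adjoint T = {(u, v). \<forall>(x, y)\<in>T. cinner y u = cinner x v}"

definition self_adjoint :: "('a::complex_inner \<times> 'a) set \<Rightarrow> bool" where
  "self_adjoint T \<longleftrightarrow> is_operator T \<and> densely_defined T \<and> adjoint T = T"

definition ker :: "('a::complex_inner \<times> 'b::complex_inner) set \<Rightarrow> 'a set" where
  "ker T = {x. (x, 0) \<in> T}"

text \<open>\<open>R = (T - z)^{-1}\<close> as an everywhere defined bounded operator.\<close>

definition is_resolvent :: "('a::complex_inner \<times> 'a) set \<Rightarrow> complex \<Rightarrow> ('a \<Rightarrow> 'a) \<Rightarrow> bool" where
  "is_resolvent T z R \<longleftrightarrow> bounded_clinear R \<and> (\<forall>x y. (x, y) \<in> T \<longleftrightarrow> R (y - z *\<^sub>C x) = x)"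

text \<open>By the resolvent identity it does not matter at which point of the (nonempty) resolvent set
  the resolvent is required to be compact.\<close>

definition compact_resolvent :: "('a::complex_inner \<times> 'a) set \<Rightarrow> bool" where
  "compact_resolvent T \<longleftrightarrow> (\<exists>z R. is_resolvent T z R \<and> compact_operator R)"

definition bounded_commutator :: "('a::complex_inner \<times> 'a) set \<Rightarrow> ('a \<Rightarrow> 'a) \<Rightarrow> bool" where
  "bounded_commutator T A \<longleftrightarrow> A ` Domain T \<subseteq> Domain T \<and>
     (\<exists>C. \<forall>x y w. (x, y) \<in> T \<longrightarrow> (A x, w) \<in> T \<longrightarrow> norm (w - A y) \<le> C * norm x)"

text \<open>\<open>S\<close> is a core of \<open>T\<close>: \<open>T\<close> is the closure of its restriction to \<open>S\<close>.\<close>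

definition is_core :: "'a::complex_inner set \<Rightarrow> ('a \<times> 'b::complex_inner) set \<Rightarrow> bool" where
  "is_core S T \<longleftrightarrow> S \<subseteq> Domain T \<and> closure (T \<inter> S \<times> UNIV) = T"

text \<open>For a densely defined operator with closed range, the kernel of the adjoint is the
  orthogonal complement of the range, hence represents the cokernel.\<close>

definition fredholm :: "('a::complex_inner \<times> 'b::complex_inner) set \<Rightarrow> bool" where
  "fredholm T \<longleftrightarrow> is_operator T \<and> densely_defined T \<and> closed T \<and> closed (Range T) \<and>
     finite_dim (ker T) \<and> finite_dim (ker (adjoint T))"

definition fredholm_index :: "('a::complex_inner \<times> 'b::complex_inner) set \<Rightarrow> int" where
  "fredholm_index T = int (complex_vector.dim (ker T)) - int (complex_vector.dim (ker (adjoint T)))"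

text \<open>The operator matrix with rows \<open>(0, T)\<close> and \<open>(T*, 0)\<close>.\<close>

definition off_diagonal :: "('a::complex_inner \<times> 'b::complex_inner) set \<Rightarrow> (('b \<times> 'a) \<times> ('b \<times> 'a)) set" where
  "off_diagonal T = {((x1, x2), (y1, y2)). (x2, y1) \<in> T \<and> (x1, y2) \<in> adjoint T}"


section \<open>Even spectral triples\<close>

definition dense_star_subalgebra :: "('x::topological_space \<Rightarrow> complex) set \<Rightarrow> bool" where
  "dense_star_subalgebra A \<longleftrightarrow>
     (\<forall>f\<in>A. continuous_on UNIV f) \<and> (\<lambda>_. 1) \<in> A \<and>
     (\<forall>f\<in>A. \<forall>g\<in>A. (\<lambda>x. f x + g x) \<in> A \<and> (\<lambda>x. f x * g x) \<in> A) \<and>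
     (\<forall>f\<in>A. \<forall>c. (\<lambda>x. c * f x) \<in> A) \<and> (\<forall>f\<in>A. (\<lambda>x. cnj (f x)) \<in> A) \<and>
     (\<forall>f. continuous_on UNIV f \<longrightarrow> (\<forall>e>0. \<exists>g\<in>A. \<forall>x. norm (f x - g x) < e))"

definition star_representation ::
    "('x \<Rightarrow> complex) set \<Rightarrow> (('x \<Rightarrow> complex) \<Rightarrow> 'h \<Rightarrow> 'h::complex_inner) \<Rightarrow> bool" where
  "star_representation A \<pi> \<longleftrightarrow>
     (\<forall>f\<in>A. bounded_clinear (\<pi> f)) \<and> \<pi> (\<lambda>_. 1) = id \<and>
     (\<forall>f\<in>A. \<forall>g\<in>A. \<forall>u. \<pi> (\<lambda>x. f x + g x) u = \<pi> f u + \<pi> g u \<and> \<pi> (\<lambda>x. f x * g x) u = \<pi> f (\<pi> g u)) \<and>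
     (\<forall>f\<in>A. \<forall>c u. \<pi> (\<lambda>x. c * f x) u = c *\<^sub>C \<pi> f u) \<and>
     (\<forall>f\<in>A. \<forall>u v. cinner (\<pi> f u) v = cinner u (\<pi> (\<lambda>x. cnj (f x)) v))"

definition grading ::
    "('x \<Rightarrow> complex) set \<Rightarrow> (('x \<Rightarrow> complex) \<Rightarrow> 'h \<Rightarrow> 'h) \<Rightarrow> ('h \<times> 'h) set \<Rightarrow> ('h \<Rightarrow> 'h::complex_inner) \<Rightarrow> bool" where
  "grading A \<pi> T \<gamma> \<longleftrightarrow>
     bounded_clinear \<gamma> \<and> (\<forall>u. \<gamma> (\<gamma> u) = u) \<and> (\<forall>u v. cinner (\<gamma> u) v = cinner u (\<gamma> v)) \<and>
     (\<forall>f\<in>A. \<forall>u. \<gamma> (\<pi> f u) = \<pi> f (\<gamma> u)) \<and> (\<forall>(x, y)\<in>T. (\<gamma> x, - \<gamma> y) \<in> T)"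

definition even_spectral_triple ::
    "('x::topological_space \<Rightarrow> complex) set \<Rightarrow> (('x \<Rightarrow> complex) \<Rightarrow> 'h \<Rightarrow> 'h) \<Rightarrow>
     ('h \<times> 'h) set \<Rightarrow> ('h \<Rightarrow> 'h::complex_inner) \<Rightarrow> bool" where
  "even_spectral_triple A \<pi> T \<gamma> \<longleftrightarrow>
     dense_star_subalgebra A \<and> star_representation A \<pi> \<and>
     self_adjoint T \<and> compact_resolvent T \<and> (\<forall>f\<in>A. bounded_commutator T (\<pi> f)) \<and>
     grading A \<pi> T \<gamma>"


section \<open>The Hilbert space of square integrable functions\<close>

definition square_integrable :: "('p::prime_card padic_int \<Rightarrow> complex) \<Rightarrow> bool" where
  "square_integrable f \<longleftrightarrow> f \<in> borel_measurable haar \<and> integrable haar (\<lambda>x. (norm (f x))\<^sup>2)"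

lemma measurable_cnj [measurable (raw)]:
  "f \<in> borel_measurable M \<Longrightarrow> (\<lambda>x. cnj (f x)) \<in> borel_measurable M"
  by (rule borel_measurable_continuous_on[OF continuous_on_cnj[OF continuous_on_id]])

lemma square_integrable_mult:
  assumes "square_integrable f" "square_integrable g"
  shows "integrable haar (\<lambda>x. f x * cnj (g x))"
proof (rule Bochner_Integration.integrable_bound)
  show "integrable haar (\<lambda>x. (norm (f x))\<^sup>2 + (norm (g x))\<^sup>2)"
    using assms by (auto simp: square_integrable_def)
  show "(\<lambda>x. f x * cnj (g x)) \<in> borel_measurable haar"
    using assms by (auto simp: square_integrable_def)
  show "AE x in haar. norm (f x * cnj (g x)) \<le> norm ((norm (f x))\<^sup>2 + (norm (g x))\<^sup>2)"
  proof (rule AE_I2)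
    fix x
    have "2 * (norm (f x) * norm (g x)) \<le> (norm (f x))\<^sup>2 + (norm (g x))\<^sup>2"
      using sum_squares_bound[of "norm (f x)" "norm (g x)"] by simp
    moreover have "0 \<le> norm (f x) * norm (g x)" by simp
    ultimately have "norm (f x) * norm (g x) \<le> (norm (f x))\<^sup>2 + (norm (g x))\<^sup>2" by linarith
    then show "norm (f x * cnj (g x)) \<le> norm ((norm (f x))\<^sup>2 + (norm (g x))\<^sup>2)"
      by (simp add: norm_mult)
  qed
qed

lemma square_integrable_add:
  assumes "square_integrable f" "square_integrable g"
  shows "square_integrable (\<lambda>x. f x + g x)"
  unfolding square_integrable_def
proof
  show m: "(\<lambda>x. f x + g x) \<in> borel_measurable haar"
    using assms by (auto simp: square_integrable_def)
  show "integrable haar (\<lambda>x. (norm (f x + g x))\<^sup>2)"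
  proof (rule Bochner_Integration.integrable_bound)
    show "integrable haar (\<lambda>x. 2 * (norm (f x))\<^sup>2 + 2 * (norm (g x))\<^sup>2)"
      using assms by (auto simp: square_integrable_def)
    show "(\<lambda>x. (norm (f x + g x))\<^sup>2) \<in> borel_measurable haar" using m by measurable
    show "AE x in haar. norm ((norm (f x + g x))\<^sup>2) \<le> norm (2 * (norm (f x))\<^sup>2 + 2 * (norm (g x))\<^sup>2)"
    proof (rule AE_I2)
      fix x
      have "(norm (f x + g x))\<^sup>2 \<le> (norm (f x) + norm (g x))\<^sup>2"
        by (intro power_mono norm_triangle_ineq) simp
      also have "\<dots> \<le> 2 * (norm (f x))\<^sup>2 + 2 * (norm (g x))\<^sup>2"
        using sum_squares_bound[of "norm (f x)" "norm (g x)"] by (simp add: power2_sum)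
      finally show "norm ((norm (f x + g x))\<^sup>2) \<le> norm (2 * (norm (f x))\<^sup>2 + 2 * (norm (g x))\<^sup>2)"
        by simp
    qed
  qed
qed

lemma square_integrable_scale:
  "square_integrable f \<Longrightarrow> square_integrable (\<lambda>x. c * f x)"
  by (auto simp: square_integrable_def norm_mult power_mult_distrib)

lemma square_integrable_zero: "square_integrable (\<lambda>_. 0)"
  by (auto simp: square_integrable_def)

lemma L2_cinner_commute:
  "(\<integral>x. f x * cnj (g x) \<partial>haar) = cnj (\<integral>x. g x * cnj (f x) \<partial>haar)"
proof -
  have "cnj (\<integral>x. g x * cnj (f x) \<partial>haar) = (\<integral>x. cnj (g x * cnj (f x)) \<partial>haar)"
    by (rule Bochner_Integration.integral_cnj[symmetric])
  also have "\<dots> = (\<integral>x. f x * cnj (g x) \<partial>haar)"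
    by (simp only: complex_cnj_mult complex_cnj_cnj mult.commute)
  finally show ?thesis by (rule sym)
qed

lemma L2_cinner_add:
  assumes "square_integrable f" "square_integrable g" "square_integrable h"
  shows "(\<integral>x. (f x + g x) * cnj (h x) \<partial>haar) = (\<integral>x. f x * cnj (h x) \<partial>haar) + (\<integral>x. g x * cnj (h x) \<partial>haar)"
proof -
  have "(\<integral>x. (f x + g x) * cnj (h x) \<partial>haar) = (\<integral>x. f x * cnj (h x) + g x * cnj (h x) \<partial>haar)"
    by (simp only: distrib_right)
  also have "\<dots> = (\<integral>x. f x * cnj (h x) \<partial>haar) + (\<integral>x. g x * cnj (h x) \<partial>haar)"
    using square_integrable_mult[OF assms(1,3)] square_integrable_mult[OF assms(2,3)]
    by (rule Bochner_Integration.integral_add)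
  finally show ?thesis .
qed

lemma L2_cinner_self:
  "Re (\<integral>x. f x * cnj (f x) \<partial>haar) = (\<integral>x. (norm (f x))\<^sup>2 \<partial>haar)"
proof -
  have "(\<lambda>x. f x * cnj (f x)) = (\<lambda>x. complex_of_real ((norm (f x))\<^sup>2))"
    by (rule ext) (rule complex_norm_square[symmetric])
  then have "(\<integral>x. f x * cnj (f x) \<partial>haar) = complex_of_real (\<integral>x. (norm (f x))\<^sup>2 \<partial>haar)"
    using integral_complex_of_real[of haar "\<lambda>x. (norm (f x))\<^sup>2"] by (simp only:)
  then show ?thesis by (simp only: Re_complex_of_real)
qed

lemma L2_cinner_nonneg: "0 \<le> Re (\<integral>x. f x * cnj (f x) \<partial>haar)"
proof -
  have "0 \<le> (\<integral>x. (norm (f x))\<^sup>2 \<partial>haar)"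
    by (rule integral_nonneg_AE) simp
  then show ?thesis by (simp only: L2_cinner_self)
qed

lemma L2_cinner_eq_0:
  assumes "square_integrable f"
  shows "Re (\<integral>x. f x * cnj (f x) \<partial>haar) = 0 \<longleftrightarrow> (AE x in haar. f x = 0)"
proof -
  have "integrable haar (\<lambda>x. (norm (f x))\<^sup>2)" using assms by (simp add: square_integrable_def)
  then have "(\<integral>x. (norm (f x))\<^sup>2 \<partial>haar) = 0 \<longleftrightarrow> (AE x in haar. (norm (f x))\<^sup>2 = 0)"
    by (rule integral_nonneg_eq_0_iff_AE) simp
  then show ?thesis unfolding L2_cinner_self by simp
qed

quotient_type (overloaded) 'p L2 = "'p::prime_card padic_int \<Rightarrow> complex" / partial:
  "\<lambda>f g. square_integrable f \<and> square_integrable g \<and> (AE x in haar. f x = g x)"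
  morphisms rep_L2 L2_class
proof (rule part_equivpI)
  show "\<exists>f::'p padic_int \<Rightarrow> complex. square_integrable f \<and> square_integrable f \<and> (AE x in haar. f x = f x)"
    using square_integrable_zero by auto
  show "symp (\<lambda>f g::'p padic_int \<Rightarrow> complex. square_integrable f \<and> square_integrable g \<and> (AE x in haar. f x = g x))"
    by (rule sympI) (auto elim: eventually_mono)
  show "transp (\<lambda>f g::'p padic_int \<Rightarrow> complex. square_integrable f \<and> square_integrable g \<and> (AE x in haar. f x = g x))"
    by (rule transpI) (auto elim: eventually_elim2)
qed

instantiation L2 :: (prime_card) complex_inner
begin

lift_definition zero_L2 :: "'a L2" is "\<lambda>_. 0" by (simp add: square_integrable_zero)

lift_definition plus_L2 :: "'a L2 \<Rightarrow> 'a L2 \<Rightarrow> 'a L2" is "\<lambda>f g x. f x + g x"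
  by (auto intro: square_integrable_add elim: eventually_elim2)

lift_definition scaleC_L2 :: "complex \<Rightarrow> 'a L2 \<Rightarrow> 'a L2" is "\<lambda>c f x. c * f x"
  by (auto intro: square_integrable_scale elim: eventually_mono)

lift_definition cinner_L2 :: "'a L2 \<Rightarrow> 'a L2 \<Rightarrow> complex" is "\<lambda>f g. \<integral>x. f x * cnj (g x) \<partial>haar"
proof -
  fix f f' g g' :: "'a padic_int \<Rightarrow> complex"
  assume a: "square_integrable f \<and> square_integrable f' \<and> (AE x in haar. f x = f' x)"
    "square_integrable g \<and> square_integrable g' \<and> (AE x in haar. g x = g' x)"
  then have [measurable]: "f \<in> borel_measurable haar" "f' \<in> borel_measurable haar"
      "g \<in> borel_measurable haar" "g' \<in> borel_measurable haar"
    by (auto simp: square_integrable_def)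
  from a have "AE x in haar. f x = f' x" "AE x in haar. g x = g' x" by auto
  then have "AE x in haar. f x * cnj (g x) = f' x * cnj (g' x)" by eventually_elim simp
  then show "(\<integral>x. f x * cnj (g x) \<partial>haar) = (\<integral>x. f' x * cnj (g' x) \<partial>haar)"
    by (intro integral_cong_AE) auto
qed

definition "uminus_L2 (u :: 'a L2) = (- 1) *\<^sub>C u"
definition "minus_L2 (u :: 'a L2) v = u + - v"
definition "scaleR_L2 r (u :: 'a L2) = complex_of_real r *\<^sub>C u"
definition "inner_L2 (u :: 'a L2) v = Re (cinner u v)"
definition "norm_L2 (u :: 'a L2) = sqrt (inner u u)"
definition "dist_L2 (u :: 'a L2) v = norm (u - v)"
definition "sgn_L2 (u :: 'a L2) = scaleR (inverse (norm u)) u"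
definition uniformity_L2 :: "('a L2 \<times> 'a L2) filter" where
  "uniformity_L2 = (INF e\<in>{0<..}. principal {(x, y). dist x y < e})"
definition open_L2 :: "'a L2 set \<Rightarrow> bool" where
  "open_L2 U = (\<forall>x\<in>U. \<forall>\<^sub>F (x', y) in uniformity. x' = x \<longrightarrow> y \<in> U)"

instance
proof
  fix x y z :: "'a L2" and b c :: complex and r s :: real
  show add_assoc: "x + y + z = x + (y + z)" by transfer (auto intro!: square_integrable_add simp: add_ac)
  show "x + y = y + x" by transfer (auto intro!: square_integrable_add simp: add_ac)
  show "0 + x = x" by transfer (auto intro!: square_integrable_add)
  have sC: "c *\<^sub>C (u + v) = c *\<^sub>C u + c *\<^sub>C v" "(b + c) *\<^sub>C u = b *\<^sub>C u + c *\<^sub>C u"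
    "b *\<^sub>C c *\<^sub>C u = (b * c) *\<^sub>C u" "1 *\<^sub>C u = u" "0 *\<^sub>C u = 0" for u v :: "'a L2" and b c :: complex
    by (transfer; auto intro!: square_integrable_add square_integrable_scale square_integrable_zero
          simp: algebra_simps)+
  show "- x + x = 0"
    using sC(2)[of "-1" 1 x] sC(4)[of x] sC(5)[of x] by (simp add: uminus_L2_def)
  show "x - y = x + - y" by (simp add: minus_L2_def)
  show "r *\<^sub>R (x + y) = r *\<^sub>R x + r *\<^sub>R y" "(r + s) *\<^sub>R x = r *\<^sub>R x + s *\<^sub>R x"
    "r *\<^sub>R s *\<^sub>R x = (r * s) *\<^sub>R x" "1 *\<^sub>R x = x"
    unfolding scaleR_L2_def by (simp_all add: sC)
  show "c *\<^sub>C (x + y) = c *\<^sub>C x + c *\<^sub>C y" "(b + c) *\<^sub>C x = b *\<^sub>C x + c *\<^sub>C x"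
    "b *\<^sub>C c *\<^sub>C x = (b * c) *\<^sub>C x" "complex_of_real r *\<^sub>C x = r *\<^sub>R x"
    by (simp_all add: sC scaleR_L2_def)
  show "dist x y = norm (x - y)" by (simp add: dist_L2_def)
  show "sgn x = inverse (norm x) *\<^sub>R x" by (simp add: sgn_L2_def)
  show "uniformity = (INF e\<in>{0<..}. principal {(x :: 'a L2, y). dist x y < e})"
    by (simp add: uniformity_L2_def)
  show "open U = (\<forall>x\<in>U. \<forall>\<^sub>F (x', y) in uniformity. x' = x \<longrightarrow> y \<in> U)" for U :: "'a L2 set"
    by (simp add: open_L2_def)
  show comm: "cinner x y = cnj (cinner y x)" for x y :: "'a L2"
    by transfer (rule L2_cinner_commute)
  show ca: "cinner (x + y) z = cinner x z + cinner y z"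
    by transfer (rule L2_cinner_add; blast)
  show cs: "cinner (c *\<^sub>C x) y = c * cinner x y" for c
    by transfer (simp add: mult.assoc)
  show "Re (cinner x y) = inner x y" by (simp add: inner_L2_def)
  show "inner x y = inner y x"
    unfolding inner_L2_def using comm[of x y] by simp
  show "inner (x + y) z = inner x z + inner y z" unfolding inner_L2_def by (simp add: ca)
  show "inner (r *\<^sub>R x) y = r * inner x y" unfolding inner_L2_def scaleR_L2_def by (simp add: cs)
  show "0 \<le> inner x x" unfolding inner_L2_def
    by transfer (rule L2_cinner_nonneg)
  show "(inner x x = 0) = (x = 0)" unfolding inner_L2_def
  proof transfer
    fix f :: "'a padic_int \<Rightarrow> complex"
    assume "square_integrable f \<and> square_integrable f \<and> (AE x in haar. f x = f x)"
    then show "(Re (\<integral>x. f x * cnj (f x) \<partial>haar) = 0) =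
        (square_integrable f \<and> square_integrable (\<lambda>_::'a padic_int. 0) \<and> (AE x in haar. f x = 0))"
      using L2_cinner_eq_0[of f] square_integrable_zero by blast
  qed
  show "norm x = sqrt (inner x x)" by (simp add: norm_L2_def)
qed

end

text \<open>The GNS representation of the Haar state: \<open>f\<close> acts as multiplication by \<open>f\<close>.\<close>

definition gns :: "('p::prime_card padic_int \<Rightarrow> complex) \<Rightarrow> 'p L2 \<Rightarrow> 'p L2" where
  "gns f u = L2_class (\<lambda>x. f x * rep_L2 u x)"

end

theory Submission
  imports Defs "HOL-Algebra.Coset"
begin

text \<open>
  The operator \<open>D\<close> sends each character \<open>\<psi>\<close> to a multiple of a character \<open>\<Phi> \<psi>\<close>, where \<open>\<Phi>\<close> is
  injective because \<open>D\<close> is. The weights tend to infinity by compactness of the resolvent, so a bounded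
  commutator with \<open>\<psi>\<close> forces \<open>\<Phi> (\<psi> * \<eta>) = \<psi> * \<Phi> \<eta>\<close> for all but finitely many \<open>\<eta>\<close>. The characters
  outside the range of \<open>\<Phi>\<close> are orthogonal to the range of \<open>D\<close>, hence finite in number, and this number is
  divisible by the order of every finite subgroup of the dual group. The dual is the Pruefer group, which has
  subgroups of order \<open>p^k\<close> for all \<open>k\<close>; so \<open>\<Phi>\<close> is onto, \<open>D\<close> has dense range, and the index vanishes.
\<close>

section \<open>Almost equivariant injections of groups\<close>

text \<open>The exceptions to equivariance depend on the character, and a nonempty finite set cannot
  be invariant under the whole infinite dual. So one finite subgroup is treated at a time: the union
  of its exceptional sets is still finite, and its orbits can be counted. Torsion is decisive. On
  the integers, the map that fixes n \<ge> 0 and sends n < 0 to n - 1 is injective, commutes with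
  every translation up to finitely many exceptions, and misses -1. The commutator step rests on
  orthonormality: multiples of two different characters are at least as far apart as the modulus of
  either coefficient, so a bounded commutator leaves no room for a mismatch at a large weight. Since
  \<open>chi\<close> and \<open>haar\<close> are definite descriptions, nothing is known about them
  before existence and uniqueness are shown. This is why the characters are classified by roots of
  unity and Haar measure is built from random digits.\<close>

lemma (in group) card_subgroup_dvd_card_invariant:
  assumes H: "subgroup H G" and "finite S" "S \<subseteq> carrier G"
    and inv: "\<And>h x. h \<in> H \<Longrightarrow> x \<in> S \<Longrightarrow> h \<otimes> x \<in> S"
  shows "card H dvd card S"
proof -
  \<comment> \<open>The invariant set is a disjoint union of right cosets of \<open>H\<close>, each
    of cardinality \<open>card H\<close>.\<close>
  let ?C = "(\<lambda>x. H #> x) ` S"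
  have rc: "?C \<subseteq> rcosets H"
    using assms(3) by (auto simp: RCOSETS_def)
  have U: "\<Union>?C = S"
  proof
    show "\<Union>?C \<subseteq> S" using inv by (auto simp: r_coset_def)
    show "S \<subseteq> \<Union>?C" using rcos_self[OF _ H] assms(3) by blast
  qed
  have "card H dvd card (\<Union>?C)"
  proof (rule dvd_partition)
    show "finite (\<Union>?C)" using U assms(2) by simp
    have "card c = card H" if "c \<in> ?C" for c
      using card_rcosets_equal[of c H] rc that subgroup.subset[OF H] by auto
    then show "\<forall>c\<in>?C. card H dvd card c" by simp
    show "\<forall>c1\<in>?C. \<forall>c2\<in>?C. c1 \<noteq> c2 \<longrightarrow> c1 \<inter> c2 = {}"
      using rcos_disjoint[OF H] rc unfolding pairwise_def disjnt_def by blast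
  qed
  then show ?thesis using U by simp
qed

text \<open>If \<open>F\<close> is a finite \<open>H\<close>-invariant set outside of which \<open>f\<close> commutes with \<open>H\<close>, then both \<open>F\<close> and
  the complement of \<open>f ` (carrier G - F)\<close> are \<open>H\<close>-invariant; by injectivity their cardinalities
  differ by that of \<open>carrier G - f ` carrier G\<close>.\<close>

lemma (in group) card_subgroup_dvd_card_coimage:
  assumes H: "subgroup H G" "finite H"
    and f: "f \<in> carrier G \<rightarrow> carrier G" "inj_on f (carrier G)"
    and fin: "finite (carrier G - f ` carrier G)"
    and eqv: "\<And>h. h \<in> H \<Longrightarrow> finite {x \<in> carrier G. f (h \<otimes> x) \<noteq> h \<otimes> f x}"
  shows "card H dvd card (carrier G - f ` carrier G)"
proof -
  interpret H: subgroup H G by (rule H)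
  define E where "E = (\<Union>h\<in>H. {x \<in> carrier G. f (h \<otimes> x) \<noteq> h \<otimes> f x})"
  \<comment> \<open>\<open>E\<close> collects the exceptions for all of \<open>H\<close> but need
    not be invariant; \<open>F\<close> is its saturation under \<open>H\<close>, still
    finite.\<close>
  define F where "F = (\<lambda>(h, x). h \<otimes> x) ` (H \<times> E)"
  have EG: "E \<subseteq> carrier G" and FG: "F \<subseteq> carrier G" by (auto simp: E_def F_def)
  have "finite E" using H eqv by (auto simp: E_def)
  then have finF: "finite F" using H by (auto simp: F_def)
  have invF: "h \<otimes> x \<in> F" if h: "h \<in> H" and x: "x \<in> F" for h x
  proof -
    obtain k e where ke: "k \<in> H" "e \<in> E" "x = k \<otimes> e" using x by (auto simp: F_def)
    have "h \<otimes> x = (h \<otimes> k) \<otimes> e" using ke h EG by (auto simp: m_assoc)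
    then show ?thesis using ke h unfolding F_def by (auto intro!: image_eqI[where x="(h \<otimes> k, e)"])
  qed
  have invF': "h \<otimes> x \<notin> F" if h: "h \<in> H" and x: "x \<in> carrier G" "x \<notin> F" for h x
  proof
    assume "h \<otimes> x \<in> F"
    then have "inv h \<otimes> (h \<otimes> x) \<in> F" using h by (rule_tac invF) auto
    then show False using x h by (simp add: m_assoc[symmetric])
  qed
  have EF: "E \<subseteq> F"
  proof
    fix x assume x: "x \<in> E"
    then have "x = \<one> \<otimes> x" using EG by auto
    then show "x \<in> F" using x unfolding F_def by (auto intro!: image_eqI[where x="(\<one>, x)"])
  qed
  have eq: "f (h \<otimes> x) = h \<otimes> f x" if "h \<in> H" "x \<in> carrier G" "x \<notin> F" for h x
    using that EF by (auto simp: E_def)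
  define S where "S = carrier G - f ` (carrier G - F)"
  have SU: "S = f ` F \<union> (carrier G - f ` carrier G)"
    using f FG unfolding S_def by (auto dest: inj_onD)
  have finS: "finite S" using SU finF fin by simp
  have cS: "card S = card F + card (carrier G - f ` carrier G)"
    unfolding SU using FG finF fin
    by (subst card_Un_disjoint) (auto simp: card_image[OF inj_on_subset[OF f(2)]])
  have "card H dvd card F"
    by (rule card_subgroup_dvd_card_invariant[OF H(1) finF FG invF])
  moreover have "card H dvd card S"
  proof (rule card_subgroup_dvd_card_invariant[OF H(1) finS])
    show "S \<subseteq> carrier G" by (auto simp: S_def)
    fix h y assume h: "h \<in> H" and y: "y \<in> S"
    show "h \<otimes> y \<in> S"
    proof (rule ccontr)
      assume "h \<otimes> y \<notin> S"
      then obtain x where x: "x \<in> carrier G" "x \<notin> F" "h \<otimes> y = f x"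
        using h y by (auto simp: S_def)
      have "y = inv h \<otimes> (h \<otimes> y)" using h y by (simp add: S_def flip: m_assoc)
      also have "\<dots> = inv h \<otimes> f x" using x by simp
      also have "\<dots> = f (inv h \<otimes> x)" using eq x h by simp
      finally have "y = f (inv h \<otimes> x)" .
      moreover have "inv h \<otimes> x \<in> carrier G - F" using invF'[of "inv h" x] x h by simp
      ultimately show False using y unfolding S_def by blast
    qed
  qed
  ultimately show ?thesis unfolding cS by (simp add: dvd_add_right_iff)
qed

text \<open>A natural number divisible by a larger one is 0, so a single finite subgroup bigger than
  the coimage suffices.\<close>

corollary (in group) almost_equivariant_surj:
  assumes f: "f \<in> carrier G \<rightarrow> carrier G" "inj_on f (carrier G)"
    and fin: "finite (carrier G - f ` carrier G)"
    and eqv: "\<And>g. g \<in> carrier G \<Longrightarrow> finite {x \<in> carrier G. f (g \<otimes> x) \<noteq> g \<otimes> f x}"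
    and big: "\<And>n. \<exists>H. subgroup H G \<and> finite H \<and> card H > n"
  shows "f ` carrier G = carrier G"
proof -
  obtain H where H: "subgroup H G" "finite H" "card H > card (carrier G - f ` carrier G)"
    using big by blast
  have "card H dvd card (carrier G - f ` carrier G)"
    using H subgroup.subset[OF H(1)] by (intro card_subgroup_dvd_card_coimage f fin eqv) auto
  then have "card (carrier G - f ` carrier G) = 0"
    using H(3) by (auto dest: dvd_imp_le)
  then show ?thesis using fin f by auto
qed

section \<open>The dual group of the \<open>p\<close>-adic integers\<close>

abbreviation cyl :: "nat \<Rightarrow> int \<Rightarrow> 'p::prime_card padic_int set" where
  "cyl n r \<equiv> {x. residue x n = r}"

lemma CARD_prime_card_gt_1: "CARD('p::prime_card) > 1"
  using prm_gt_1[where 'p='p] by simp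

lemma less_power_CARD: "n < CARD('p::prime_card) ^ n"
  using CARD_prime_card_gt_1[where 'p='p] by (simp add: power_gt_expt)

lemma residue_of_nat: "residue (of_nat m :: 'p::prime_card padic_int) n = int m mod prm TYPE('p) ^ n"
proof (induction m)
  case 0
  then show ?case by (simp add: zero_padic_int.rep_eq)
next
  case (Suc m)
  then show ?case
    by (simp add: plus_padic_int.rep_eq one_padic_int.rep_eq mod_simps)
qed

lemma open_cyl: "open (cyl n r)"
  by (auto simp: open_padic_int_def)

lemma continuous_on_locally_constant:
  fixes f :: "'p::prime_card padic_int \<Rightarrow> 'b::topological_space"
  assumes "\<And>x y. residue x n = residue y n \<Longrightarrow> f x = f y"
  shows "continuous_on UNIV f"
  unfolding continuous_on_open_vimage[OF open_UNIV] open_padic_int_def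
  using assms by (metis IntE IntI UNIV_I vimage_eq)

section \<open>Digits and the Monna map on natural numbers\<close>

lemma digit_of_nat: "digit (of_nat m :: 'p::prime_card padic_int) k = int (m div CARD('p) ^ k mod CARD('p))"
proof -
  have "m mod CARD('p) ^ Suc k = CARD('p) ^ k * (m div CARD('p) ^ k mod CARD('p)) + m mod CARD('p) ^ k"
    by (subst power_Suc2, rule mod_mult2_eq)
  then have "m mod CARD('p) ^ Suc k div CARD('p) ^ k = m div CARD('p) ^ k mod CARD('p)"
    using CARD_prime_card_gt_1[where 'p='p] by simp
  then show ?thesis
    unfolding digit_def residue_of_nat by (metis of_nat_power zdiv_int zmod_int)
qed

lemma summable_monna_of_nat:
  "summable (\<lambda>k. of_int (digit (of_nat m :: 'p::prime_card padic_int) k) / of_nat CARD('p) ^ (k + 1) :: real)"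
proof (rule summable_finite[of "{..<m}"])
  fix k assume "k \<notin> {..<m}"
  then have "m < CARD('p) ^ k" using less_power_CARD[of k, where 'p='p] by simp
  then show "of_int (digit (of_nat m :: 'p padic_int) k) / of_nat CARD('p) ^ (k + 1) = (0 :: real)"
    by (simp add: digit_of_nat)
qed simp

text \<open>Removing the lowest digit shifts the others down by one place. The bounds and the
  injectivity below are inductions along this recursion.\<close>

lemma monna_of_nat_rec:
  "monna (of_nat m :: 'p::prime_card padic_int) =
     (real (m mod CARD('p)) + monna (of_nat (m div CARD('p)) :: 'p padic_int)) / real CARD('p)"
proof -
  define f where "f m k = real_of_int (digit (of_nat m :: 'p padic_int) k) / of_nat CARD('p) ^ (k + 1)" for m k
  have monna: "monna (of_nat m :: 'p padic_int) = suminf (f m)" and summ: "summable (f m)" for m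
    using summable_monna_of_nat[where 'p='p] unfolding monna_def f_def by auto
  have "f m (Suc k) = f (m div CARD('p)) k / real CARD('p)" for k
    by (simp add: f_def digit_of_nat div_mult2_eq)
  then have "(\<Sum>k. f m (Suc k)) = suminf (f (m div CARD('p))) / real CARD('p)"
    using suminf_divide[OF summ] by simp
  moreover have "f m 0 = real (m mod CARD('p)) / real CARD('p)"
    by (simp add: f_def digit_of_nat)
  ultimately show ?thesis
    unfolding monna using suminf_split_head[OF summ[of m]] by (simp add: add_divide_distrib)
qed

lemma monna_0: "monna (0 :: 'p::prime_card padic_int) = 0"
  by (simp add: monna_def digit_def zero_padic_int.rep_eq)

text \<open>The strict upper bound reflects that natural numbers have finite expansions: at the
  p-adic integer -1, all of whose digits are p - 1, the Monna map takes the value 1.\<close>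

lemma monna_of_nat_bounds:
  "0 \<le> monna (of_nat m :: 'p::prime_card padic_int) \<and> monna (of_nat m :: 'p padic_int) < 1"
proof (induction m rule: less_induct)
  case (less m)
  show ?case
  proof (cases "m = 0")
    case False
    have p: "CARD('p) > 1" by (rule CARD_prime_card_gt_1)
    let ?t = "monna (of_nat (m div CARD('p)) :: 'p padic_int)"
    have t: "0 \<le> ?t" "?t < 1" using less[of "m div CARD('p)"] False p by auto
    have "m mod CARD('p) < CARD('p)" using p by simp
    then have "real (m mod CARD('p)) + 1 \<le> real CARD('p)" by linarith
    then have "real (m mod CARD('p)) + ?t < real CARD('p)" using t by linarith
    then show ?thesis
      using t p by (subst (1 2) monna_of_nat_rec) (simp add: field_simps)
  qed (simp add: monna_0)
qed

text \<open>After multiplication by p, the lowest digit is the integer part and the value at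
  \<open>m div p\<close> is the fractional part, so both can be recovered.\<close>

lemma inj_monna_of_nat: "inj (\<lambda>m. monna (of_nat m :: 'p::prime_card padic_int))"
proof (rule injI)
  fix m n
  assume "monna (of_nat m :: 'p padic_int) = monna (of_nat n :: 'p padic_int)"
  then show "m = n"
  proof (induction "m + n" arbitrary: m n rule: less_induct)
    case less
    have p: "CARD('p) > 1" by (rule CARD_prime_card_gt_1)
    let ?t = "\<lambda>m. monna (of_nat (m div CARD('p)) :: 'p padic_int)"
    show ?case
    proof (cases "m + n = 0")
      case False
      have eq: "real (m mod CARD('p)) + ?t m = real (n mod CARD('p)) + ?t n"
        using less.prems p
        by (subst (asm) (1 2) monna_of_nat_rec) (simp add: field_simps)
      have b: "0 \<le> ?t m" "?t m < 1" "0 \<le> ?t n" "?t n < 1"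
        using monna_of_nat_bounds by auto
      have a: "m mod CARD('p) = n mod CARD('p)" using eq b by linarith
      have "m div CARD('p) + n div CARD('p) < m + n"
        using False p by (cases "m = 0"; cases "n = 0") (auto intro!: add_strict_mono)
      moreover have "?t m = ?t n" using eq a by simp
      ultimately have "m div CARD('p) = n div CARD('p)" by (rule less.hyps)
      with a show ?thesis by (metis div_mult_mod_eq)
    qed simp
  qed
qed

section \<open>Roots of unity of p-power order\<close>

definition zeta :: "'p::prime_card itself \<Rightarrow> nat \<Rightarrow> complex" where
  "zeta _ m = exp (2 * of_real pi * \<i> * of_real (monna (of_nat m :: 'p padic_int)))"

text \<open>The p-th power multiplies the Monna value by p; the lowest digit then contributes an
  integer number of full turns and disappears.\<close>

lemma zeta_power_card: "zeta TYPE('p::prime_card) m ^ CARD('p) = zeta TYPE('p) (m div CARD('p))"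
proof -
  let ?t = "monna (of_nat (m div CARD('p)) :: 'p padic_int)"
  have p: "CARD('p) > 1" by (rule CARD_prime_card_gt_1)
  have "zeta TYPE('p) m ^ CARD('p) =
      exp (of_nat CARD('p) * (2 * of_real pi * \<i> * of_real (monna (of_nat m :: 'p padic_int))))"
    unfolding zeta_def by (rule exp_of_nat_mult[symmetric])
  also have "of_nat CARD('p) * (2 * of_real pi * \<i> * of_real (monna (of_nat m :: 'p padic_int))) =
     2 * of_real pi * \<i> * of_real ?t + of_nat (m mod CARD('p)) * (2 * of_real pi * \<i>)"
    using p by (subst monna_of_nat_rec) (simp add: field_simps)
  also have "exp \<dots> = exp (2 * of_real pi * \<i> * of_real ?t)"
    unfolding exp_add exp_of_nat_mult by simp
  finally show ?thesis unfolding zeta_def .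
qed

lemma zeta_power: "zeta TYPE('p::prime_card) m ^ (CARD('p) ^ k) = zeta TYPE('p) (m div CARD('p) ^ k)"
proof (induction k arbitrary: m)
  case (Suc k)
  then show ?case by (simp add: power_mult zeta_power_card div_mult2_eq)
qed simp

lemma zeta_0: "zeta TYPE('p::prime_card) 0 = 1"
  by (simp add: zeta_def monna_0)

lemma inj_zeta: "inj (zeta TYPE('p::prime_card))"
proof (rule injI)
  fix m n assume eq: "zeta TYPE('p) m = zeta TYPE('p) n"
  let ?t = "\<lambda>m. monna (of_nat m :: 'p padic_int)"
  obtain k :: int where "2 * of_real pi * \<i> * of_real (?t m) = 2 * of_real pi * \<i> * of_real (?t n) + of_int (2 * k) * pi * \<i>"
    using eq unfolding zeta_def exp_eq by auto
  then have "2 * pi * \<i> * of_real (?t m) = 2 * pi * \<i> * (of_real (?t n + of_int k))"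
    by (simp add: algebra_simps)
  then have "complex_of_real (?t m) = of_real (?t n + of_int k)"
    by (subst (asm) mult_cancel_left) simp
  then have k: "?t m = ?t n + of_int k" by (simp only: of_real_eq_iff)
  moreover have "k = 0"
    using k monna_of_nat_bounds[where 'p='p, of m] monna_of_nat_bounds[where 'p='p, of n] by linarith
  ultimately have "?t m = ?t n" by simp
  then show "m = n" using inj_monna_of_nat[where 'p='p] by (auto dest: injD)
qed

text \<open>Surjectivity by counting: p^k distinct values among the p^k roots of unity.\<close>

lemma zeta_image_lessThan:
  "zeta TYPE('p::prime_card) ` {..<CARD('p) ^ k} = {z. z ^ (CARD('p) ^ k) = 1}"
proof (rule card_subset_eq)
  have pos: "CARD('p) ^ k > 0" using CARD_prime_card_gt_1[where 'p='p] by simp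
  show "finite {z::complex. z ^ (CARD('p) ^ k) = 1}"
    using pos by (intro finite_roots_unity) simp
  show "zeta TYPE('p) ` {..<CARD('p) ^ k} \<subseteq> {z. z ^ (CARD('p) ^ k) = 1}"
    by (auto simp: zeta_power zeta_0)
  show "card (zeta TYPE('p) ` {..<CARD('p) ^ k}) = card {z::complex. z ^ (CARD('p) ^ k) = 1}"
    using pos by (simp add: card_roots_unity_eq card_image inj_on_subset[OF inj_zeta])
qed

section \<open>Continuous characters and their values at 1\<close>

lemma power_mod_exponent:
  fixes z :: "'a::monoid_mult"
  assumes "z ^ N = 1"
  shows "z ^ (n mod N) = z ^ n"
proof -
  have "z ^ n = z ^ (N * (n div N) + n mod N)" by simp
  also have "\<dots> = z ^ (n mod N)" unfolding power_add power_mult assms by simp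
  finally show ?thesis by simp
qed

text \<open>The root \<open>z\<close> defines a character of the finite quotient of order p^k;
  pulled back along \<open>residue\<close>, it is locally constant and hence continuous.\<close>

lemma continuous_character_root:
  assumes z: "z ^ (CARD('p::prime_card) ^ k) = 1"
  shows "continuous_character (\<lambda>x::'p padic_int. z ^ nat (residue x k))"
    and "z ^ nat (residue (1 :: 'p padic_int) k) = z"
proof -
  have red: "z ^ nat (int n mod prm TYPE('p) ^ k) = z ^ n" for n
    using power_mod_exponent[OF z, of n] by (metis nat_int of_nat_power zmod_int)
  show "z ^ nat (residue (1 :: 'p padic_int) k) = z"
    using red[of 1] by (simp add: one_padic_int.rep_eq)
  have pos: "CARD('p) ^ k > 0" using CARD_prime_card_gt_1[where 'p='p] by simp
  then have nz: "norm z = 1"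
    using z by (metis norm_ge_zero norm_one norm_power power_eq_imp_eq_base power_one zero_le_one)
  show "continuous_character (\<lambda>x::'p padic_int. z ^ nat (residue x k))"
    unfolding continuous_character_def
  proof (intro conjI allI)
    show "continuous_on UNIV (\<lambda>x::'p padic_int. z ^ nat (residue x k))"
      by (rule continuous_on_locally_constant[of k]) simp
    show "norm (z ^ nat (residue x k)) = 1" for x :: "'p padic_int"
      by (simp add: norm_power nz)
    fix x y :: "'p padic_int"
    have "residue (x + y) k = int (nat (residue x k) + nat (residue y k)) mod prm TYPE('p) ^ k"
      by (simp add: plus_padic_int.rep_eq residue_bounds)
    then show "z ^ nat (residue (x + y) k) = z ^ nat (residue x k) * z ^ nat (residue y k)"
      by (simp only: red power_add)
  qed
qed

lemma continuous_character_0: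
  assumes "continuous_character \<psi>" shows "\<psi> 0 = 1"
proof -
  have "\<psi> 0 * \<psi> 0 = \<psi> 0" "norm (\<psi> 0) = 1"
    using assms unfolding continuous_character_def by (metis add_0, blast)
  then show ?thesis by auto
qed

lemma continuous_character_of_nat:
  assumes "continuous_character \<psi>" shows "\<psi> (of_nat n) = \<psi> 1 ^ n"
proof (induction n)
  case (Suc n)
  then show ?case using assms unfolding continuous_character_def by simp
qed (simp add: continuous_character_0[OF assms])

text \<open>The natural numbers are dense: the level-n neighbourhood of \<open>x\<close> contains
  the natural number \<open>nat (residue x n)\<close>.\<close>

lemma continuous_eqI_of_nat:
  fixes f g :: "'p::prime_card padic_int \<Rightarrow> 'b::t2_space"
  assumes "continuous_on UNIV f" "continuous_on UNIV g" and "\<And>n. f (of_nat n) = g (of_nat n)"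
  shows "f = g"
proof (rule ccontr)
  assume "f \<noteq> g"
  then obtain x where x: "f x \<noteq> g x" by auto
  have "open {x. f x \<noteq> g x}" using assms by (intro open_Collect_neq) auto
  then obtain n where n: "\<And>y. residue y n = residue x n \<Longrightarrow> f y \<noteq> g y"
    using x unfolding open_padic_int_def by auto
  have "residue (of_nat (nat (residue x n)) :: 'p padic_int) n = residue x n"
    by (simp only: residue_of_nat int_nat_eq residue_bounds if_True residue_mod)
  then show False using n assms(3) by blast
qed

lemma continuous_character_eqI:
  assumes "continuous_character \<psi>" "continuous_character \<psi>'" "\<psi> 1 = \<psi>' 1"
  shows "\<psi> = \<psi>'"
  using assms
  by (intro continuous_eqI_of_nat) (auto simp: continuous_character_def continuous_character_of_nat)

text \<open>The unit circle has no small subgroups: doubling increases the distance to 1 by a factor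
  of at least 3/2 as long as that distance is at most 1/2.\<close>

lemma power_near_1_imp_eq_1:
  fixes w :: complex
  assumes near: "\<And>j. norm (w ^ j - 1) < 1 / 2"
  shows "w = 1"
proof (rule ccontr)
  assume "w \<noteq> 1"
  then have d: "norm (w - 1) > 0" by simp
  have grow: "(3/2) ^ j * norm (w - 1) \<le> norm (w ^ 2 ^ j - 1)" for j
  proof (induction j)
    case (Suc j)
    let ?v = "w ^ 2 ^ j"
    \<comment> \<open>Squaring multiplies the distance to 1 by \<open>norm (?v + 1)\<close>, which
      is at least 2 - 1/2.\<close>
    have "norm (2 :: complex) \<le> norm (?v + 1) + norm (1 - ?v)"
      using norm_triangle_ineq[of "?v + 1" "1 - ?v"] by simp
    then have "3 / 2 \<le> norm (?v + 1)" using near[of "2 ^ j"] by (simp add: norm_minus_commute)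
    then have "(3/2) * ((3/2) ^ j * norm (w - 1)) \<le> norm (?v + 1) * norm (?v - 1)"
      using Suc by (intro mult_mono) auto
    also have "\<dots> = norm ((?v + 1) * (?v - 1))" by (simp only: norm_mult)
    also have "(?v + 1) * (?v - 1) = w ^ 2 ^ Suc j - 1"
      by (simp add: algebra_simps power2_eq_square power_mult flip: power_add)
    finally show ?case by simp
  qed simp
  obtain j where "1 / norm (w - 1) < (3/2) ^ j"
    using real_arch_pow[of "3/2" "1 / norm (w - 1)"] by auto
  then have "1 < (3/2) ^ j * norm (w - 1)" using d by (simp add: field_simps)
  then show False using grow[of j] near[of "2 ^ j"] by linarith
qed

text \<open>By continuity some subgroup of multiples of p^n is mapped close to 1. Its image is a
  subgroup of the circle and so trivial, which makes the value at p^n equal to 1.\<close>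

lemma continuous_character_1_root:
  assumes \<psi>: "continuous_character (\<psi> :: 'p::prime_card padic_int \<Rightarrow> complex)"
  shows "\<exists>k. \<psi> 1 ^ (CARD('p) ^ k) = 1"
proof -
  have cont: "continuous_on UNIV \<psi>" using \<psi> by (simp add: continuous_character_def)
  have "open {x. norm (\<psi> x - 1) < 1 / 2}"
    by (intro open_Collect_less continuous_intros cont)
  moreover have "0 \<in> {x. norm (\<psi> x - 1) < 1 / 2}" by (simp add: continuous_character_0[OF \<psi>])
  ultimately obtain n where "\<forall>y. residue y n = residue (0 :: 'p padic_int) n \<longrightarrow> y \<in> {x. norm (\<psi> x - 1) < 1 / 2}"
    unfolding open_padic_int_def by blast
  then have n: "norm (\<psi> y - 1) < 1 / 2" if "residue y n = residue (0 :: 'p padic_int) n" for y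
    using that by simp
  have "norm ((\<psi> 1 ^ (CARD('p) ^ n)) ^ j - 1) < 1 / 2" for j
  proof -
    have "norm (\<psi> (of_nat (CARD('p) ^ n * j)) - 1) < 1 / 2"
      by (rule n, unfold residue_of_nat) (simp add: zero_padic_int.rep_eq)
    then show ?thesis by (simp only: continuous_character_of_nat[OF \<psi>] power_mult)
  qed
  then show ?thesis using power_near_1_imp_eq_1 by blast
qed

text \<open>The description defining \<open>chi n\<close> is legitimate: since n < p^n, the
  prescribed value is a root of unity of p-power order and extends to a character, and the value at
  1 determines a continuous character.\<close>

lemma chi: "continuous_character (chi n :: 'p::prime_card padic_int \<Rightarrow> complex)"
    and chi_1: "chi n (1 :: 'p padic_int) = zeta TYPE('p) n"
proof -
  have "n < CARD('p) ^ n" by (rule less_power_CARD)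
  then have "zeta TYPE('p) n ^ (CARD('p) ^ n) = 1" by (simp add: zeta_power zeta_0)
  from continuous_character_root[OF this]
  have "\<exists>!\<psi> :: 'p padic_int \<Rightarrow> complex. continuous_character \<psi> \<and> \<psi> 1 = zeta TYPE('p) n"
    by (auto intro: continuous_character_eqI)
  from theI'[OF this] show "continuous_character (chi n :: 'p padic_int \<Rightarrow> complex)"
    "chi n (1 :: 'p padic_int) = zeta TYPE('p) n"
    unfolding chi_def zeta_def by blast+
qed

text \<open>Every value at 1 is a root of unity of p-power order, hence some \<open>zeta\<close>.
  This completeness lets maps on indices be read as maps on characters.\<close>

lemma range_chi: "range chi = {\<psi> :: 'p::prime_card padic_int \<Rightarrow> complex. continuous_character \<psi>}"
proof -
  have "\<psi> \<in> range chi" if \<psi>: "continuous_character \<psi>" for \<psi> :: "'p padic_int \<Rightarrow> complex"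
  proof -
    obtain k where "\<psi> 1 ^ (CARD('p) ^ k) = 1" using continuous_character_1_root[OF \<psi>] by blast
    then have "\<psi> 1 \<in> zeta TYPE('p) ` {..<CARD('p) ^ k}" by (simp add: zeta_image_lessThan)
    then obtain n where "\<psi> 1 = zeta TYPE('p) n" by blast
    then have "\<psi> = chi n" by (intro continuous_character_eqI \<psi> chi) (simp add: chi_1)
    then show ?thesis by simp
  qed
  then show ?thesis using chi by auto
qed

text \<open>The dual is taken as a set of functions, not as the index set: pointwise multiplication
  of characters does not correspond to addition of the indices of \<open>chi\<close>.\<close>

definition char_group :: "('p::prime_card padic_int \<Rightarrow> complex) monoid" where
  "char_group = \<lparr>carrier = {\<psi>. continuous_character \<psi>}, mult = (\<lambda>\<psi> \<psi>' x. \<psi> x * \<psi>' x), one = (\<lambda>_. 1)\<rparr>"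

lemma char_group_simps [simp]:
  "carrier char_group = {\<psi>. continuous_character \<psi>}"
  "\<psi> \<otimes>\<^bsub>char_group\<^esub> \<psi>' = (\<lambda>x. \<psi> x * \<psi>' x)" "\<one>\<^bsub>char_group\<^esub> = (\<lambda>_. 1)"
  by (simp_all add: char_group_def)

lemma continuous_character_mult:
  "continuous_character \<psi> \<Longrightarrow> continuous_character \<psi>' \<Longrightarrow> continuous_character (\<lambda>x. \<psi> x * \<psi>' x)"
  by (auto simp: continuous_character_def norm_mult intro: continuous_intros)

lemma continuous_character_cnj: "continuous_character \<psi> \<Longrightarrow> continuous_character (\<lambda>x. cnj (\<psi> x))"
  by (auto simp: continuous_character_def intro: continuous_intros)

lemma continuous_character_one: "continuous_character (\<lambda>_. 1)"
  by (auto simp: continuous_character_def)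

lemma character_mult_cnj: "continuous_character \<psi> \<Longrightarrow> \<psi> x * cnj (\<psi> x) = 1"
  by (simp add: continuous_character_def flip: complex_norm_square)

lemma group_char_group: "group char_group"
proof (rule groupI)
  fix \<psi> :: "'a padic_int \<Rightarrow> complex" assume "\<psi> \<in> carrier char_group"
  then show "\<exists>\<psi>'\<in>carrier char_group. \<psi>' \<otimes>\<^bsub>char_group\<^esub> \<psi> = \<one>\<^bsub>char_group\<^esub>"
    by (intro bexI[of _ "\<lambda>x. cnj (\<psi> x)"])
      (auto simp: continuous_character_cnj character_mult_cnj mult.commute)
qed (auto simp: continuous_character_mult continuous_character_one mult.assoc)

text \<open>The witness consists of the characters whose p^n-th power is trivial. Evaluation at 1
  matches it with the p^n-th roots of unity, and p^n > n.\<close>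

lemma char_group_large_finite_subgroup:
  "\<exists>H. subgroup H (char_group :: ('p::prime_card padic_int \<Rightarrow> complex) monoid) \<and> finite H \<and> card H > n"
proof -
  interpret group "char_group :: ('p padic_int \<Rightarrow> complex) monoid" by (rule group_char_group)
  define H where "H = {\<psi> :: 'p padic_int \<Rightarrow> complex. continuous_character \<psi> \<and> \<psi> 1 ^ (CARD('p) ^ n) = 1}"
  have pos: "CARD('p) ^ n > 0" using CARD_prime_card_gt_1[where 'p='p] by simp
  have "bij_betw (\<lambda>\<psi>. \<psi> 1) H {z. z ^ (CARD('p) ^ n) = 1}"
    unfolding bij_betw_def
  proof
    show "inj_on (\<lambda>\<psi>. \<psi> 1) H" by (auto intro!: inj_onI continuous_character_eqI simp: H_def)
    show "(\<lambda>\<psi>. \<psi> 1) ` H = {z. z ^ (CARD('p) ^ n) = 1}"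
    proof (safe)
      fix z :: complex assume z: "z ^ (CARD('p) ^ n) = 1"
      show "z \<in> (\<lambda>\<psi>. \<psi> 1) ` H"
        using continuous_character_root[OF z] z
        by (intro image_eqI[of _ _ "\<lambda>x. z ^ nat (residue x n)"]) (auto simp: H_def)
    qed (simp add: H_def)
  qed
  then have "card H = CARD('p) ^ n" "finite H"
    using card_roots_unity_eq[OF pos] finite_roots_unity[of "CARD('p) ^ n"] pos
    by (auto simp: bij_betw_same_card bij_betw_finite)
  moreover have "n < CARD('p) ^ n" by (rule less_power_CARD)
  moreover have "subgroup H char_group"
  proof (rule subgroupI)
    fix \<psi> assume \<psi>: "\<psi> \<in> H"
    have "inv\<^bsub>char_group\<^esub> \<psi> = (\<lambda>x. cnj (\<psi> x))"
      using \<psi> by (intro inv_equality)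
        (auto simp: H_def continuous_character_cnj character_mult_cnj mult.commute)
    then show "inv\<^bsub>char_group\<^esub> \<psi> \<in> H"
      using \<psi> by (auto simp: H_def continuous_character_cnj simp flip: complex_cnj_power)
  qed (auto simp: H_def power_mult_distrib continuous_character_mult intro: continuous_character_one)
  ultimately show ?thesis by auto
qed

section \<open>Haar measure\<close>

text \<open>The cylinders form a countable base, so each open set is a countable union of them. The
  empty set is listed because disjoint cylinders intersect in it.\<close>

lemma sets_borel_padic_int:
  "sets (borel :: 'p::prime_card padic_int measure) = sigma_sets UNIV (insert {} (range (\<lambda>(n, r). cyl n r)))"
proof -
  have "sets (borel :: 'p padic_int measure) = sigma_sets UNIV {S. open S}"
    by (simp add: borel_def)
  also have "\<dots> = sigma_sets UNIV (insert {} (range (\<lambda>(n, r). cyl n r)))" (is "_ = sigma_sets UNIV ?C")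
  proof (rule sigma_sets_eqI)
    fix U :: "'p padic_int set" assume "U \<in> {S. open S}"
    then have U: "open U" by simp
    define K where "K = {C \<in> range (\<lambda>(n, r). cyl n r). C \<subseteq> U}"
    have "countable K"
      unfolding K_def by (rule countable_subset[of _ "range (\<lambda>(n, r). cyl n r)"]) auto
    have "U = \<Union>K"
    proof
      show "U \<subseteq> \<Union>K"
      proof
        fix x assume x: "x \<in> U"
        then obtain n where "cyl n (residue x n) \<subseteq> U" using U unfolding open_padic_int_def by blast
        then have "cyl n (residue x n) \<in> K" unfolding K_def by auto
        then show "x \<in> \<Union>K" by auto
      qed
    qed (auto simp: K_def)
    also have "\<Union>K \<in> sigma_sets UNIV ?C"
      by (rule sigma_sets_UNION) (auto simp: \<open>countable K\<close> K_def intro!: sigma_sets.Basic)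
    finally show "U \<in> sigma_sets UNIV ?C" .
  next
    fix C :: "'p padic_int set" assume "C \<in> ?C"
    then show "C \<in> sigma_sets UNIV {S. open S}" by (auto intro!: sigma_sets.Basic open_cyl)
  qed
  finally show ?thesis .
qed

text \<open>Ultrametric geometry: two cylinders are disjoint or nested.\<close>

lemma Int_stable_cyl:
  "Int_stable (insert {} (range (\<lambda>(n, r). cyl n r :: 'p::prime_card padic_int set)))"
proof -
  let ?c = "cyl :: nat \<Rightarrow> int \<Rightarrow> 'p padic_int set"
  have nested: "?c m r \<inter> ?c n s = {} \<or> ?c m r \<inter> ?c n s = ?c n s" if "m \<le> n" for m n r s
  proof (cases "?c m r \<inter> ?c n s = {}")
    case False
    then obtain z :: "'p padic_int" where "residue z m = r" "residue z n = s" by auto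
    then have "residue y m = r" if "residue y n = s" for y :: "'p padic_int"
      using residue_eq_le[OF \<open>m \<le> n\<close>, of y z] that by simp
    then show ?thesis by blast
  qed simp
  show ?thesis
    unfolding Int_stable_def
  proof (intro ballI)
    fix A B assume A: "A \<in> insert {} (range (\<lambda>(n, r). ?c n r))"
      and B: "B \<in> insert {} (range (\<lambda>(n, r). ?c n r))"
    have "A \<inter> B = {} \<or> A \<inter> B = B \<or> A \<inter> B = A"
    proof (cases "A = {} \<or> B = {}")
      case False
      then obtain m r n s where "A = ?c m r" "B = ?c n s" using A B by auto
      then show ?thesis
        using nested[of m n r s] nested[of n m s r] le_cases[of m n] by (metis Int_commute)
    qed auto
    then show "A \<inter> B \<in> insert {} (range (\<lambda>(n, r). ?c n r))"
      using A B by (elim disjE) simp_all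
  qed
qed

lemma cyl_eq_empty: "r \<notin> {0..<prm TYPE('p) ^ n} \<Longrightarrow> (cyl n r :: 'p::prime_card padic_int set) = {}"
  using residue_bounds by force

text \<open>The uniqueness theorem for measures on an intersection-stable generator. It serves both
  the uniqueness of Haar measure and the invariance of the measure constructed below; the whole
  space is itself a cylinder, of level 0.\<close>

lemma measure_eqI_cyl:
  fixes M N :: "'p::prime_card padic_int measure"
  assumes "sets M = sets borel" "sets N = sets borel" "emeasure M UNIV \<noteq> \<infinity>"
    and eq: "\<And>n r. r \<in> {0..<prm TYPE('p) ^ n} \<Longrightarrow> emeasure M (cyl n r) = emeasure N (cyl n r)"
  shows "M = N"
proof (rule measure_eqI_generator_eq[where A="\<lambda>_. UNIV" and \<Omega>=UNIV, OF Int_stable_cyl[where 'p='p]])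
  show "sets M = sigma_sets UNIV (insert {} (range (\<lambda>(n, r). cyl n r)))"
    "sets N = sigma_sets UNIV (insert {} (range (\<lambda>(n, r). cyl n r)))"
    using assms by (simp_all add: sets_borel_padic_int)
  have "(UNIV :: 'p padic_int set) = cyl 0 0"
  proof -
    have "residue x 0 = 0" for x :: "'p padic_int" using residue_bounds[of x 0] by simp
    then show ?thesis by auto
  qed
  then have "(UNIV :: 'p padic_int set) = (\<lambda>(n, r). cyl n r) (0, 0)" by simp
  then show "range (\<lambda>_. UNIV) \<subseteq> insert {} (range (\<lambda>(n, r). cyl n r :: 'p padic_int set))"
    by (metis image_subsetI insertCI rangeI)
  fix X :: "'p padic_int set" assume "X \<in> insert {} (range (\<lambda>(n, r). cyl n r))"
  then consider "X = {}" | n r where "X = cyl n r" by auto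
  then show "emeasure M X = emeasure N X"
  proof cases
    case (2 n r)
    then show ?thesis using eq[of r n] cyl_eq_empty[of r n, where 'p='p] by (cases "r \<in> {0..<prm TYPE('p) ^ n}") auto
  qed simp
qed (use assms in auto)

lemma measurable_translation: "(\<lambda>x. a + x :: 'p::prime_card padic_int) \<in> borel_measurable borel"
proof (rule borel_measurable_continuous_onI)
  have "\<exists>n. \<forall>y. residue y n = residue x n \<longrightarrow> a + y \<in> B" if B: "open B" "a + x \<in> B" for B x
  proof -
    obtain n where "\<forall>y. residue y n = residue (a + x) n \<longrightarrow> y \<in> B"
      using B unfolding open_padic_int_def by blast
    then show ?thesis by (intro exI[of _ n]) (simp add: plus_padic_int.rep_eq)
  qed
  then show "continuous_on UNIV (\<lambda>x. a + x)"
    unfolding continuous_on_open_vimage[OF open_UNIV] by (simp add: open_padic_int_def[of "_ -` _"])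
qed

lemma vimage_translation_cyl:
  "(\<lambda>x. a + x) -` cyl n r = (cyl n ((r - residue a n) mod prm TYPE('p) ^ n) :: 'p::prime_card padic_int set)"
  if "r \<in> {0..<prm TYPE('p) ^ n}"
proof -
  have "((residue a n + residue x n) mod prm TYPE('p) ^ n = r) \<longleftrightarrow>
    residue x n = (r - residue a n) mod prm TYPE('p) ^ n" for x :: "'p padic_int"
  proof
    assume "(residue a n + residue x n) mod prm TYPE('p) ^ n = r"
    then have "(r - residue a n) mod prm TYPE('p) ^ n = residue x n mod prm TYPE('p) ^ n"
      by (auto simp: mod_simps)
    then show "residue x n = (r - residue a n) mod prm TYPE('p) ^ n" by simp
  next
    assume "residue x n = (r - residue a n) mod prm TYPE('p) ^ n"
    then show "(residue a n + residue x n) mod prm TYPE('p) ^ n = r"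
      using that by (simp add: mod_simps)
  qed
  then show ?thesis by (auto simp: plus_padic_int.rep_eq)
qed

text \<open>The p^n cylinders of level n partition the space and are translates of one another, so
  they share the total mass 1 equally.\<close>

lemma is_haar_cyl:
  fixes \<mu> :: "'p::prime_card padic_int measure"
  assumes "is_haar \<mu>" and r: "r \<in> {0..<prm TYPE('p) ^ n}"
  shows "emeasure \<mu> (cyl n r) = ennreal (1 / real CARD('p) ^ n)"
proof -
  interpret prob_space \<mu> using assms by (simp add: is_haar_def)
  have sets[measurable_cong]: "sets \<mu> = sets borel" using assms by (simp add: is_haar_def)
  then have sp: "space \<mu> = UNIV" by (metis sets_eq_imp_space_eq space_borel)
  have cs: "cyl m s \<in> sets \<mu>" for m s by (simp add: sets open_cyl borel_open)
  have inv: "measure \<mu> (cyl n s) = measure \<mu> (cyl n 0)" if s: "s \<in> {0..<prm TYPE('p) ^ n}" for s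
  proof -
    \<comment> \<open>Translation by this element pulls the cylinder of residue \<open>s\<close>
      back to that of residue 0.\<close>
    let ?a = "of_nat (nat s) :: 'p padic_int"
    have "residue ?a n = s" using s unfolding residue_of_nat by simp
    moreover have "measure \<mu> (cyl n s) = measure (distr \<mu> borel (\<lambda>x. ?a + x)) (cyl n s)"
      using assms by (simp add: is_haar_def)
    moreover have "\<dots> = measure \<mu> ((\<lambda>x. ?a + x) -` cyl n s)"
    proof -
      have "(\<lambda>x. ?a + x) \<in> measurable \<mu> borel"
        using measurable_translation by (simp add: measurable_cong_sets[OF sets refl])
      then show ?thesis using cs[of n s] sp sets by (subst measure_distr) auto
    qed
    ultimately show ?thesis using vimage_translation_cyl[OF s, of ?a] by simp
  qed
  have "1 = measure \<mu> (\<Union>s\<in>{0..<prm TYPE('p) ^ n}. cyl n s)"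
  proof -
    have "(\<Union>s\<in>{0..<prm TYPE('p) ^ n}. cyl n s) = (UNIV :: 'p padic_int set)"
      using residue_bounds by auto
    then show ?thesis using prob_space sp by simp
  qed
  also have "\<dots> = (\<Sum>s\<in>{0..<prm TYPE('p) ^ n}. measure \<mu> (cyl n s))"
    by (rule finite_measure_finite_Union) (auto simp: cs disjoint_family_on_def)
  also have "\<dots> = (\<Sum>s\<in>{0..<prm TYPE('p) ^ n}. measure \<mu> (cyl n r))"
    by (rule sum.cong[OF refl]) (simp only: inv inv[OF r])
  also have "\<dots> = real CARD('p) ^ n * measure \<mu> (cyl n r)"
    unfolding sum_constant by (simp add: nat_power_eq)
  finally have "measure \<mu> (cyl n r) = 1 / real CARD('p) ^ n"
    using CARD_prime_card_gt_1[where 'p='p] by (simp add: field_simps)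
  then show ?thesis by (simp add: emeasure_eq_measure)
qed

section \<open>Construction of Haar measure from random digits\<close>

definition digit_sum :: "int \<Rightarrow> (nat \<Rightarrow> int) \<Rightarrow> nat \<Rightarrow> int" where
  "digit_sum P \<omega> n = (\<Sum>k<n. (\<omega> k mod P) * P ^ k)"

lemma digit_sum_Suc: "digit_sum P \<omega> (Suc n) = digit_sum P \<omega> n + (\<omega> n mod P) * P ^ n"
  by (simp add: digit_sum_def)

lemma digit_sum_bounds:
  assumes "P > 1" shows "digit_sum P \<omega> n \<in> {0..<P ^ n}"
proof (induction n)
  case (Suc n)
  have "0 \<le> \<omega> n mod P" "\<omega> n mod P \<le> P - 1" using assms by auto
  then have "0 \<le> (\<omega> n mod P) * P ^ n" "(\<omega> n mod P) * P ^ n \<le> (P - 1) * P ^ n"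
    using assms by (auto intro!: mult_right_mono)
  then show ?case using Suc by (auto simp: digit_sum_Suc algebra_simps)
qed (simp add: digit_sum_def)

text \<open>Uniqueness of base-P digits, by comparison modulo P^n. It splits membership in a
  cylinder into separate conditions on coordinates, as independence requires.\<close>

lemma digit_sum_eq_mod_iff:
  assumes "P > 1"
  shows "digit_sum P \<omega> n = r mod P ^ n \<longleftrightarrow> (\<forall>k<n. \<omega> k mod P = r div P ^ k mod P)"
proof (induction n)
  case (Suc n)
  have pos: "P ^ n > 0" using assms by simp
  have r: "r mod P ^ Suc n = r mod P ^ n + (r div P ^ n mod P) * P ^ n"
    using assms by (simp add: power_Suc2 zmod_zmult2_eq del: power_Suc)
  have "digit_sum P \<omega> (Suc n) = r mod P ^ Suc n \<longleftrightarrow>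
      digit_sum P \<omega> n = r mod P ^ n \<and> \<omega> n mod P = r div P ^ n mod P"
  proof
    assume eq: "digit_sum P \<omega> (Suc n) = r mod P ^ Suc n"
    then have eq': "digit_sum P \<omega> n + (\<omega> n mod P) * P ^ n = r mod P ^ n + (r div P ^ n mod P) * P ^ n"
      unfolding digit_sum_Suc r .
    then have "(digit_sum P \<omega> n + (\<omega> n mod P) * P ^ n) mod P ^ n = (r mod P ^ n + (r div P ^ n mod P) * P ^ n) mod P ^ n"
      by (rule arg_cong)
    then have "digit_sum P \<omega> n = r mod P ^ n" using digit_sum_bounds[OF assms, of \<omega> n] by simp
    then show "digit_sum P \<omega> n = r mod P ^ n \<and> \<omega> n mod P = r div P ^ n mod P"
      using eq' pos assms by auto
  qed (simp only: digit_sum_Suc r)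
  then show ?case using Suc by (auto simp: less_Suc_eq)
qed (simp add: digit_sum_def)

text \<open>Independent uniform digits. The underlying space contains all integer sequences, also
  those with entries outside the digit range, which is why \<open>digit_sum\<close> reduces each
  entry modulo P.\<close>

definition digit_space :: "'p::prime_card itself \<Rightarrow> (nat \<Rightarrow> int) measure" where
  "digit_space _ = PiM UNIV (\<lambda>_. measure_pmf (pmf_of_set {0..<prm TYPE('p)}))"

definition of_digits :: "(nat \<Rightarrow> int) \<Rightarrow> 'p::prime_card padic_int" where
  "of_digits \<omega> = Abs_padic_int (digit_sum (prm TYPE('p)) \<omega>)"

lemma residue_of_digits: "residue (of_digits \<omega> :: 'p::prime_card padic_int) n = digit_sum (prm TYPE('p)) \<omega> n"
proof -
  have "digit_sum (prm TYPE('p)) \<omega> (Suc n) mod prm TYPE('p) ^ n = digit_sum (prm TYPE('p)) \<omega> n" for n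
    using digit_sum_bounds[OF prm_gt_1[where 'p='p], of \<omega> n] by (simp add: digit_sum_Suc)
  then show ?thesis
    unfolding of_digits_def
    using digit_sum_bounds[OF prm_gt_1[where 'p='p], of \<omega>] by (subst Abs_padic_int_inverse) auto
qed

lemma vimage_of_digits_cyl:
  fixes r :: int
  assumes "r \<in> {0..<prm TYPE('p::prime_card) ^ n}"
  shows "of_digits -` (cyl n r :: 'p padic_int set) \<inter> space (digit_space TYPE('p)) =
    {\<omega> \<in> space (digit_space TYPE('p)). \<forall>k\<in>{..<n}. \<omega> k \<in> {d. d mod prm TYPE('p) = r div prm TYPE('p) ^ k mod prm TYPE('p)}}"
proof -
  have "r mod prm TYPE('p) ^ n = r" using assms by simp
  then have "digit_sum (prm TYPE('p)) \<omega> n = r \<longleftrightarrow>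
      (\<forall>k<n. \<omega> k mod prm TYPE('p) = r div prm TYPE('p) ^ k mod prm TYPE('p))" for \<omega>
    using digit_sum_eq_mod_iff[OF prm_gt_1[where 'p='p], of \<omega> n r] by (simp only:)
  then show ?thesis by (auto simp: residue_of_digits)
qed

lemma emeasure_digit:
  "emeasure (measure_pmf (pmf_of_set {0..<prm TYPE('p::prime_card)})) {d. d mod prm TYPE('p) = c mod prm TYPE('p)} =
    ennreal (1 / real CARD('p))"
proof -
  let ?P = "prm TYPE('p)"
  have "{0..<?P} \<inter> {d. d mod ?P = c mod ?P} = {c mod ?P}" by auto
  then show ?thesis by (simp add: emeasure_pmf_of_set)
qed

lemma of_digits_measurable: "of_digits \<in> measurable (digit_space TYPE('p)) (borel :: 'p::prime_card padic_int measure)"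
proof (rule measurable_sigma_sets[OF sets_borel_padic_int])
  fix C :: "'p padic_int set" assume "C \<in> insert {} (range (\<lambda>(n, r). cyl n r))"
  then consider "C = {}" | n r where "C = cyl n r" by auto
  then show "of_digits -` C \<inter> space (digit_space TYPE('p)) \<in> sets (digit_space TYPE('p))"
  proof cases
    case (2 n r)
    show ?thesis
    proof (cases "r \<in> {0..<prm TYPE('p) ^ n}")
      case True
      show ?thesis unfolding 2 vimage_of_digits_cyl[OF True] unfolding digit_space_def
        by measurable
    qed (simp add: 2 cyl_eq_empty)
  qed simp
qed auto

lemma emeasure_digit_space_cyl:
  assumes r: "r \<in> {0..<prm TYPE('p::prime_card) ^ n}"
  shows "emeasure (distr (digit_space TYPE('p)) borel of_digits) (cyl n r :: 'p padic_int set) = ennreal (1 / real CARD('p) ^ n)"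
proof -
  interpret product_prob_space "\<lambda>_::nat. measure_pmf (pmf_of_set {0..<prm TYPE('p)})" UNIV
    by (intro product_prob_spaceI measure_pmf.prob_space_axioms)
  have "emeasure (distr (digit_space TYPE('p)) borel of_digits) (cyl n r :: 'p padic_int set) =
    emeasure (digit_space TYPE('p)) (of_digits -` (cyl n r :: 'p padic_int set) \<inter> space (digit_space TYPE('p)))"
    by (rule emeasure_distr[OF of_digits_measurable]) (simp add: open_cyl borel_open)
  also have "\<dots> = (\<Prod>k<n. ennreal (1 / real CARD('p)))"
    unfolding vimage_of_digits_cyl[OF r] unfolding digit_space_def
    by (subst emeasure_PiM_Collect) (auto simp: emeasure_digit)
  finally show ?thesis by (simp add: ennreal_power power_divide)
qed

text \<open>Translation permutes the cylinders of each level, and by independence they all have the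
  same mass; agreement on cylinders then gives invariance.\<close>

lemma is_haar_digit_space: "is_haar (distr (digit_space TYPE('p)) borel of_digits :: 'p::prime_card padic_int measure)"
  (is "is_haar ?\<mu>")
proof -
  interpret product_prob_space "\<lambda>_::nat. measure_pmf (pmf_of_set {0..<prm TYPE('p)})" UNIV
    by (intro product_prob_spaceI measure_pmf.prob_space_axioms)
  have "prob_space (digit_space TYPE('p))"
    unfolding digit_space_def by (rule prob_space_axioms)
  then have prob: "prob_space ?\<mu>" by (rule prob_space.prob_space_distr[OF _ of_digits_measurable])
  have "distr ?\<mu> borel (\<lambda>x. a + x) = ?\<mu>" for a
  proof (rule measure_eqI_cyl)
    have m: "(\<lambda>x. a + x) \<in> measurable ?\<mu> borel" using measurable_translation by simp
    have "prob_space (distr ?\<mu> borel (\<lambda>x. a + x))"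
      using prob m by (rule prob_space.prob_space_distr)
    then show "emeasure (distr ?\<mu> borel (\<lambda>x. a + x)) UNIV \<noteq> \<infinity>"
      by (metis ennreal_one_neq_top infinity_ennreal_def prob_space.emeasure_space_1 space_borel space_distr)
    fix n r assume r: "r \<in> {0..<prm TYPE('p) ^ n}"
    have "emeasure (distr ?\<mu> borel (\<lambda>x. a + x)) (cyl n r) = emeasure ?\<mu> ((\<lambda>x. a + x) -` cyl n r)"
      by (subst emeasure_distr[OF m]) (auto simp: open_cyl borel_open)
    also have "\<dots> = emeasure ?\<mu> (cyl n r)"
      unfolding vimage_translation_cyl[OF r] by (simp only: emeasure_digit_space_cyl[OF r])
        (rule emeasure_digit_space_cyl, simp)
    finally show "emeasure (distr ?\<mu> borel (\<lambda>x. a + x)) (cyl n r) = emeasure ?\<mu> (cyl n r)" .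
  qed simp_all
  then show ?thesis using prob by (simp add: is_haar_def)
qed

text \<open>Random digits give existence; uniqueness holds because invariance already forces the
  mass of every cylinder.\<close>

lemma is_haar_haar: "is_haar (haar :: 'p::prime_card padic_int measure)"
proof -
  have "\<mu> = \<nu>" if "is_haar \<mu>" "is_haar \<nu>" for \<mu> \<nu> :: "'p padic_int measure"
  proof (rule measure_eqI_cyl)
    show "sets \<mu> = sets borel" "sets \<nu> = sets borel" using that by (simp_all add: is_haar_def)
    have "prob_space \<mu>" using that by (simp add: is_haar_def)
    then show "emeasure \<mu> UNIV \<noteq> \<infinity>"
      by (simp add: finite_measure.emeasure_finite prob_space.finite_measure)
  qed (use that in \<open>simp add: is_haar_cyl\<close>)
  then show ?thesis unfolding haar_def using is_haar_digit_space by (metis theI)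
qed

lemma sets_haar [measurable_cong]: "sets (haar :: 'p::prime_card padic_int measure) = sets borel"
  using is_haar_haar[where 'p='p] by (simp add: is_haar_def)

lemma prob_space_haar: "prob_space (haar :: 'p::prime_card padic_int measure)"
  using is_haar_haar[where 'p='p] by (simp add: is_haar_def)

lemma continuous_character_measurable:
  "continuous_character \<psi> \<Longrightarrow> (\<psi> :: 'p::prime_card padic_int \<Rightarrow> complex) \<in> borel_measurable haar"
  unfolding measurable_cong_sets[OF sets_haar refl]
  by (intro borel_measurable_continuous_onI) (simp add: continuous_character_def)

text \<open>Translation by a point \<open>a\<close> with \<open>\<psi> a \<noteq> 1\<close>
  multiplies the integral by \<open>\<psi> a\<close> and leaves it unchanged.\<close>

lemma integral_continuous_character:
  fixes \<psi> :: "'p::prime_card padic_int \<Rightarrow> complex"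
  assumes \<psi>: "continuous_character \<psi>"
  shows "(\<integral>x. \<psi> x \<partial>haar) = (if \<psi> = (\<lambda>_. 1) then 1 else 0)"
proof (cases "\<psi> = (\<lambda>_. 1)")
  case True
  then show ?thesis using prob_space.prob_space[OF prob_space_haar[where 'p='p]] by simp
next
  case False
  then obtain a where a: "\<psi> a \<noteq> 1" by auto
  have "(\<integral>x. \<psi> x \<partial>haar) = (\<integral>x. \<psi> x \<partial>distr haar borel (\<lambda>x. a + x))"
    using is_haar_haar[where 'p='p] by (simp add: is_haar_def)
  also have "\<dots> = (\<integral>x. \<psi> (a + x) \<partial>haar)"
    using measurable_translation[of a] continuous_character_measurable[OF \<psi>]
    by (intro integral_distr) (simp_all add: measurable_cong_sets[OF sets_haar refl])
  also have "\<dots> = \<psi> a * (\<integral>x. \<psi> x \<partial>haar)"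
    using \<psi> by (simp add: continuous_character_def)
  finally have "(\<psi> a - 1) * (\<integral>x. \<psi> x \<partial>haar) = 0" by (simp add: algebra_simps)
  then show ?thesis using a False by simp
qed

section \<open>Orthonormality of the characters\<close>

lemma cinner_add_right: "cinner x (y + z) = cinner x y + cinner (x :: 'a::complex_inner) z"
  using cinner_commute[of x "y + z"] cinner_commute[of x y] cinner_commute[of x z]
  by (simp add: cinner_add_left)

lemma cinner_scaleC_right: "cinner x (c *\<^sub>C y) = cnj c * cinner (x :: 'a::complex_inner) y"
  using cinner_commute[of x "c *\<^sub>C y"] cinner_commute[of x y] by (simp add: cinner_scaleC_left)

lemma cinner_zero_left [simp]: "cinner 0 (y :: 'a::complex_inner) = 0"
  using cinner_add_left[of 0 0 y] by simp

lemma cinner_zero_right [simp]: "cinner (x :: 'a::complex_inner) 0 = 0"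
  using cinner_add_right[of x 0 0] by simp

lemma cinner_sum_left: "cinner (\<Sum>i\<in>I. f i) (y :: 'a::complex_inner) = (\<Sum>i\<in>I. cinner (f i) y)"
  by (induction I rule: infinite_finite_induct) (simp_all add: cinner_add_left)

text \<open>Conjugate linearity in the second argument makes
  \<open>inner x (\<i> *\<^sub>C u)\<close> the imaginary part. Complex orthogonality becomes two
  real conditions, whose continuity is at hand.\<close>

lemma cinner_eq_0_iff:
  "cinner x u = 0 \<longleftrightarrow> inner x u = 0 \<and> inner x (\<i> *\<^sub>C u) = (0 :: real)" for u :: "'a::complex_inner"
  using Re_cinner[of x u] Re_cinner[of x "\<i> *\<^sub>C u"] by (simp add: cinner_scaleC_right complex_eq_iff)

lemma norm_scaleC: "norm (c *\<^sub>C x) = norm c * norm (x :: 'a::complex_inner)"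
proof -
  have "cinner x x = of_real (inner x x)"
    using cinner_commute[of x x] Re_cinner[of x x] by (simp add: complex_eq_iff)
  then have "cinner (c *\<^sub>C x) (c *\<^sub>C x) = c * cnj c * of_real (inner x x)"
    by (simp only: cinner_scaleC_left cinner_scaleC_right mult_ac)
  also have "\<dots> = of_real ((norm c)\<^sup>2 * (norm x)\<^sup>2)"
    by (simp only: complex_norm_square[symmetric] of_real_mult power2_norm_eq_inner[of x])
  finally have "inner (c *\<^sub>C x) (c *\<^sub>C x) = (norm c)\<^sup>2 * (norm x)\<^sup>2"
    unfolding Re_cinner[symmetric] by (simp only: Re_complex_of_real)
  then have "(norm (c *\<^sub>C x))\<^sup>2 = (norm c * norm x)\<^sup>2"
    by (simp add: power2_norm_eq_inner power_mult_distrib)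
  then show ?thesis by (rule power2_eq_imp_eq) simp_all
qed

lemma norm_diff_orthogonal:
  assumes "cinner x y = 0"
  shows "(norm (x - y))\<^sup>2 = (norm x)\<^sup>2 + (norm (y :: 'a::complex_inner))\<^sup>2"
proof -
  have "inner x y = 0" using assms Re_cinner[of x y] by simp
  then show ?thesis by (simp add: power2_norm_eq_inner inner_diff_left inner_diff_right inner_commute)
qed

lemma closed_cinner_eq_0: "closed {x. cinner x (u :: 'a::complex_inner) = 0}"
  unfolding cinner_eq_0_iff by (intro closed_Collect_conj closed_Collect_eq continuous_intros)

lemma orthonormal_independent:
  fixes S :: "'a::complex_inner set"
  assumes "\<And>x y. x \<in> S \<Longrightarrow> y \<in> S \<Longrightarrow> cinner x y = (if x = y then 1 else 0)"
  shows "complex_vector.independent S"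
  unfolding complex_vector.dependent_explicit
proof (safe)
  fix t u v
  assume t: "finite t" "t \<subseteq> S" "(\<Sum>v\<in>t. u v *\<^sub>C v) = 0" and v: "v \<in> t" "u v \<noteq> 0"
  have on: "cinner w v = (if w = v then 1 else 0)" if "w \<in> t" for w
    using assms[of w v] t(2) v(1) that by blast
  have "0 = cinner (\<Sum>v\<in>t. u v *\<^sub>C v) v" unfolding t(3) by simp
  also have "\<dots> = (\<Sum>w\<in>t. u w * cinner w v)" by (simp add: cinner_sum_left cinner_scaleC_left)
  also have "\<dots> = (\<Sum>w\<in>t. if w = v then u w else 0)"
    by (intro sum.cong) (simp_all add: on)
  also have "\<dots> = u v" using t v by simp
  finally show False using v by simp
qed

section \<open>Characters as vectors of \<open>L2\<close>\<close>

lemma L2_class_add: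
  assumes "square_integrable f" "square_integrable g"
  shows "L2_class (\<lambda>x. f x + g x) = L2_class f + L2_class g"
  using assms by (simp add: plus_L2.abs_eq)

lemma L2_class_scale:
  assumes "square_integrable f"
  shows "L2_class (\<lambda>x. c * f x) = c *\<^sub>C L2_class f"
  using assms by (simp add: scaleC_L2.abs_eq)

lemma cinner_L2_class:
  assumes "square_integrable f" "square_integrable g"
  shows "cinner (L2_class f) (L2_class g) = (\<integral>x. f x * cnj (g x) \<partial>haar)"
  using assms by (simp add: cinner_L2.abs_eq)

lemma square_integrable_character:
  assumes "continuous_character \<psi>" shows "square_integrable (\<psi> :: 'p::prime_card padic_int \<Rightarrow> complex)"
proof -
  interpret prob_space "haar :: 'p padic_int measure" by (rule prob_space_haar)
  show ?thesis using assms continuous_character_measurable[OF assms]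
    by (simp add: square_integrable_def continuous_character_def)
qed

text \<open>The product of one character with the conjugate of another is a character, trivial
  exactly when the two agree.\<close>

lemma cinner_character:
  assumes "continuous_character \<psi>" "continuous_character \<eta>"
  shows "cinner (L2_class \<psi>) (L2_class \<eta>) = (if \<psi> = \<eta> then 1 else 0)"
proof -
  have "(\<lambda>x. \<psi> x * cnj (\<eta> x)) = (\<lambda>_. 1) \<longleftrightarrow> \<psi> = \<eta>"
  proof
    assume eq: "(\<lambda>x. \<psi> x * cnj (\<eta> x)) = (\<lambda>_. 1)"
    show "\<psi> = \<eta>"
    proof
      fix x
      have "\<psi> x = \<psi> x * cnj (\<eta> x) * \<eta> x"
        using character_mult_cnj[OF assms(2), of x] by (simp add: mult_ac)
      also have "\<dots> = \<eta> x" using fun_cong[OF eq, of x] by simp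
      finally show "\<psi> x = \<eta> x" .
    qed
  qed (simp add: character_mult_cnj[OF assms(2)])
  then show ?thesis
    using assms
    by (simp add: cinner_L2_class square_integrable_character integral_continuous_character
        continuous_character_mult continuous_character_cnj)
qed

lemma norm_character: "continuous_character \<psi> \<Longrightarrow> norm (L2_class \<psi>) = 1"
  using Re_cinner[of "L2_class \<psi>" "L2_class \<psi>"] by (simp add: cinner_character norm_eq_sqrt_inner)

text \<open>Pythagoras, in the form used to separate characters: for injectivity of the shift, for
  discreteness against compactness, and for the commutator estimate.\<close>

lemma norm_diff_characters:
  assumes "continuous_character \<psi>" "continuous_character \<eta>" "\<psi> \<noteq> \<eta>"
  shows "(norm (a *\<^sub>C L2_class \<psi> - b *\<^sub>C L2_class \<eta>))\<^sup>2 = (norm a)\<^sup>2 + (norm b)\<^sup>2"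
  using assms
  by (subst norm_diff_orthogonal)
    (simp_all add: cinner_scaleC_left cinner_scaleC_right cinner_character norm_scaleC norm_character)

text \<open>\<open>gns\<close> multiplies a chosen representative, which agrees with
  \<open>f\<close> only almost everywhere. The bound on \<open>g\<close> keeps that product square
  integrable, so both products represent the same class.\<close>

lemma gns_L2_class:
  assumes "square_integrable f" "square_integrable (\<lambda>x. g x * f x)" "g \<in> borel_measurable haar"
    "\<And>x. norm (g x) \<le> 1"
  shows "gns g (L2_class f) = L2_class (\<lambda>x. g x * f x)"
proof -
  let ?R = "\<lambda>f g :: 'a padic_int \<Rightarrow> complex. square_integrable f \<and> square_integrable g \<and> (AE x in haar. f x = g x)"
  let ?h = "rep_L2 (L2_class f)"
  have h: "?R ?h f"
    using assms(1) by (intro Quotient3_rep_abs[OF Quotient3_L2]) simp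
  have "integrable haar (\<lambda>x. (norm (g x * ?h x))\<^sup>2)"
  proof (rule Bochner_Integration.integrable_bound)
    show "integrable haar (\<lambda>x. (norm (?h x))\<^sup>2)" using h by (simp add: square_integrable_def)
    show "(\<lambda>x. (norm (g x * ?h x))\<^sup>2) \<in> borel_measurable haar"
      using h assms(3) by (auto simp: square_integrable_def)
    have "norm (g x) * norm (?h x) \<le> norm (?h x)" for x
      using mult_right_mono[OF assms(4)[of x], of "norm (?h x)"] by simp
    then show "AE x in haar. norm ((norm (g x * ?h x))\<^sup>2) \<le> norm ((norm (?h x))\<^sup>2)"
      by (auto simp: norm_mult intro!: AE_I2 power_mono)
  qed
  then have "square_integrable (\<lambda>x. g x * ?h x)"
    using h assms(3) by (auto simp: square_integrable_def)
  moreover have "AE x in haar. g x * ?h x = g x * f x" using h by auto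
  ultimately have "?R (\<lambda>x. g x * ?h x) (\<lambda>x. g x * f x)" using assms(2) by blast
  then show ?thesis unfolding gns_def by (rule Quotient3_rel_abs[OF Quotient3_L2])
qed

lemma gns_character:
  assumes \<psi>: "continuous_character \<psi>" and \<eta>: "continuous_character \<eta>"
  shows "gns \<psi> (c *\<^sub>C L2_class \<eta>) = c *\<^sub>C L2_class (\<lambda>x. \<psi> x * \<eta> x)"
proof -
  have \<psi>\<eta>: "square_integrable (\<lambda>x. \<psi> x * \<eta> x)"
    by (intro square_integrable_character continuous_character_mult \<psi> \<eta>)
  have "gns \<psi> (c *\<^sub>C L2_class \<eta>) = gns \<psi> (L2_class (\<lambda>x. c * \<eta> x))"
    by (simp add: L2_class_scale square_integrable_character \<eta>)
  also have "\<dots> = L2_class (\<lambda>x. \<psi> x * (c * \<eta> x))"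
  proof (rule gns_L2_class)
    show "square_integrable (\<lambda>x. c * \<eta> x)"
      by (intro square_integrable_scale square_integrable_character \<eta>)
    show "square_integrable (\<lambda>x. \<psi> x * (c * \<eta> x))"
      using square_integrable_scale[OF \<psi>\<eta>, of c] by (simp add: mult_ac)
    show "\<psi> \<in> borel_measurable haar" by (rule continuous_character_measurable[OF \<psi>])
    show "norm (\<psi> x) \<le> 1" for x using \<psi> by (simp add: continuous_character_def)
  qed
  also have "(\<lambda>x. \<psi> x * (c * \<eta> x)) = (\<lambda>x. c * (\<psi> x * \<eta> x))" by (simp add: mult_ac)
  finally show ?thesis by (simp add: L2_class_scale \<psi>\<eta>)
qed

lemma gns_character_zero: "continuous_character \<psi> \<Longrightarrow> gns \<psi> 0 = 0"
  using gns_character[of \<psi> "\<lambda>_. 1" 0] by (simp add: continuous_character_one)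

lemma L2_class_sum_characters:
  assumes "finite F" "\<forall>\<psi>\<in>F. continuous_character \<psi>"
  shows "square_integrable (\<lambda>x. \<Sum>\<psi>\<in>F. c \<psi> * \<psi> x) \<and>
    L2_class (\<lambda>x. \<Sum>\<psi>\<in>F. c \<psi> * \<psi> x) = (\<Sum>\<psi>\<in>F. c \<psi> *\<^sub>C L2_class \<psi>)"
  using assms
proof (induction F rule: finite_induct)
  case empty
  then show ?case by (simp add: square_integrable_zero zero_L2_def)
next
  case (insert \<psi> F)
  then have "square_integrable \<psi>" by (simp add: square_integrable_character)
  with insert show ?case
    by (simp add: square_integrable_add square_integrable_scale L2_class_add L2_class_scale)
qed

lemma character_in_trig_poly:
  assumes "continuous_character \<psi>" shows "\<psi> \<in> trig_poly"
  unfolding trig_poly_def using assms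
  by (intro CollectI exI[of _ "{\<psi>}"] exI[of _ "\<lambda>_. 1"]) simp

lemma trig_poly_class:
  assumes "u \<in> L2_class ` trig_poly"
  obtains F c where "finite F" "\<forall>\<psi>\<in>F. continuous_character \<psi>" "u = (\<Sum>\<psi>\<in>F. c \<psi> *\<^sub>C L2_class \<psi>)"
proof -
  obtain F c where "finite F" "\<forall>\<psi>\<in>F. continuous_character \<psi>" "u = L2_class (\<lambda>x. \<Sum>\<psi>\<in>F. c \<psi> * \<psi> x)"
    using assms unfolding trig_poly_def by auto
  then show thesis using that L2_class_sum_characters by blast
qed

section \<open>Weighted shifts of the characters\<close>

text \<open>The weights and the index map are indexed by characters, so that equivariance under
  multiplication can be stated. \<open>core\<close> is what carries information from the characters
  to all of \<open>D\<close>.\<close>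

locale character_shift =
  fixes D :: "('p::prime_card L2 \<times> 'p L2) set"
    and \<mu> :: "('p padic_int \<Rightarrow> complex) \<Rightarrow> complex"
    and \<Phi> :: "('p padic_int \<Rightarrow> complex) \<Rightarrow> 'p padic_int \<Rightarrow> complex"
  assumes operator: "is_operator D"
    and core: "is_core (L2_class ` trig_poly) D"
    and injective: "ker D = {0}"
    and character_\<Phi>: "continuous_character \<psi> \<Longrightarrow> continuous_character (\<Phi> \<psi>)"
    and shift: "continuous_character \<psi> \<Longrightarrow> (L2_class \<psi>, \<mu> \<psi> *\<^sub>C L2_class (\<Phi> \<psi>)) \<in> D"
begin

lemma subspace: "complex_vector.subspace D"
  using operator by (simp add: is_operator_def)

lemma functional: "(x, y) \<in> D \<Longrightarrow> (x, z) \<in> D \<Longrightarrow> y = z"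
  using operator by (auto simp: is_operator_def single_valued_def)

lemma weight_nonzero: "continuous_character \<psi> \<Longrightarrow> \<mu> \<psi> \<noteq> 0"
proof
  assume \<psi>: "continuous_character \<psi>" and "\<mu> \<psi> = 0"
  then have "L2_class \<psi> \<in> ker D" using shift[OF \<psi>] by (simp add: ker_def)
  then show False using injective norm_character[OF \<psi>] by simp
qed

text \<open>If two characters had the same image, their combination with crossed weights would be
  killed by \<open>D\<close>; its squared norm is the sum of two positive squares.\<close>

lemma shift_inj: "inj_on \<Phi> {\<psi>. continuous_character \<psi>}"
proof (rule inj_onI, rule ccontr)
  fix \<psi> \<eta> assume "\<psi> \<in> {\<psi>. continuous_character \<psi>}" "\<eta> \<in> {\<psi>. continuous_character \<psi>}"
    and eq: "\<Phi> \<psi> = \<Phi> \<eta>" and ne: "\<psi> \<noteq> \<eta>"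
  then have \<psi>: "continuous_character \<psi>" and \<eta>: "continuous_character \<eta>" by auto
  have "\<mu> \<eta> *\<^sub>C (L2_class \<psi>, \<mu> \<psi> *\<^sub>C L2_class (\<Phi> \<psi>)) - \<mu> \<psi> *\<^sub>C (L2_class \<eta>, \<mu> \<eta> *\<^sub>C L2_class (\<Phi> \<eta>)) \<in> D"
    by (intro complex_vector.subspace_diff complex_vector.subspace_scale subspace shift \<psi> \<eta>)
  moreover have "\<mu> \<eta> *\<^sub>C \<mu> \<psi> *\<^sub>C L2_class (\<Phi> \<psi>) = \<mu> \<psi> *\<^sub>C \<mu> \<eta> *\<^sub>C L2_class (\<Phi> \<eta>)"
    unfolding eq scaleC_scaleC by (simp only: mult.commute)
  ultimately have "(\<mu> \<eta> *\<^sub>C L2_class \<psi> - \<mu> \<psi> *\<^sub>C L2_class \<eta>, 0) \<in> D"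
    by (simp only: scaleC_prod_def fst_conv snd_conv diff_Pair diff_self)
  then have "\<mu> \<eta> *\<^sub>C L2_class \<psi> - \<mu> \<psi> *\<^sub>C L2_class \<eta> \<in> ker D"
    unfolding ker_def by (rule CollectI)
  then have "\<mu> \<eta> *\<^sub>C L2_class \<psi> - \<mu> \<psi> *\<^sub>C L2_class \<eta> = 0"
    unfolding injective by (rule singletonD)
  then have "(norm (\<mu> \<eta>))\<^sup>2 + (norm (\<mu> \<psi>))\<^sup>2 = 0"
    using norm_diff_characters[OF \<psi> \<eta> ne, of "\<mu> \<eta>" "\<mu> \<psi>"] by simp
  then show False using weight_nonzero[OF \<psi>] by simp
qed

text \<open>With first component 0, the adjoint enters only through its value 0 at 0. Vectors of
  this form test the matrix operator with nothing else known about the adjoint.\<close>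

lemma off_diagonal_shift:
  "continuous_character \<psi> \<Longrightarrow> ((0, L2_class \<psi>), (\<mu> \<psi> *\<^sub>C L2_class (\<Phi> \<psi>), 0)) \<in> off_diagonal D"
  using shift by (auto simp: off_diagonal_def adjoint_def)

text \<open>For bounded weights, the resolvent maps vectors of bounded norm to the vectors
  \<open>(0, L2_class \<psi>)\<close>. After scaling these lie in a compact set while keeping a
  fixed distance from one another, so there are finitely many.\<close>

lemma finite_bounded_weights:
  assumes "compact_resolvent (off_diagonal D)"
  shows "finite {\<psi>. continuous_character \<psi> \<and> norm (\<mu> \<psi>) \<le> C}" (is "finite ?A")
proof -
  obtain z R where R: "is_resolvent (off_diagonal D) z R" and cpt: "compact_operator R"
    using assms by (auto simp: compact_resolvent_def)
  have lin: "bounded_linear R" using R by (simp add: is_resolvent_def bounded_clinear_def)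
  \<comment> \<open>A bound for the norm of the vector \<open>w\<close> below; the absolute value
    and the summand 1 make it positive for every \<open>C\<close>.\<close>
  define K where "K = \<bar>C\<bar> + norm z + 1"
  have K: "K > 0" by (simp add: K_def add_nonneg_pos)
  define f :: "('p padic_int \<Rightarrow> complex) \<Rightarrow> 'p L2 \<times> 'p L2" where "f \<psi> = (1 / K) *\<^sub>R (0, L2_class \<psi>)" for \<psi>
  have sep: "\<psi> = \<eta>" if \<psi>: "continuous_character \<psi>" and \<eta>: "continuous_character \<eta>"
    and d: "dist (f \<psi>) (f \<eta>) < 1 / K" for \<psi> \<eta>
  proof (rule ccontr)
    assume "\<psi> \<noteq> \<eta>"
    from norm_diff_characters[OF \<psi> \<eta> this, of 1 1]
    have "1 \<le> (norm (L2_class \<psi> - L2_class \<eta>))\<^sup>2" by (simp add: scaleC_one)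
    then have "1 \<le> norm (L2_class \<psi> - L2_class \<eta>)"
      using power2_le_imp_le[of 1 "norm (L2_class \<psi> - L2_class \<eta>)"] by simp
    moreover have "dist (f \<psi>) (f \<eta>) = (1 / K) * norm (L2_class \<psi> - L2_class \<eta>)"
      using K by (simp add: f_def dist_norm norm_Pair scaleR_diff_right[symmetric])
    ultimately show False using d K by (simp add: field_simps)
  qed
  have im: "f \<psi> \<in> R ` cball 0 1" if "\<psi> \<in> ?A" for \<psi>
  proof -
    have \<psi>: "continuous_character \<psi>" and le: "norm (\<mu> \<psi>) \<le> C" using that by auto
    define w where "w = (\<mu> \<psi> *\<^sub>C L2_class (\<Phi> \<psi>), 0) - z *\<^sub>C (0, L2_class \<psi>)"
    have "R w = (0, L2_class \<psi>)"
      using R off_diagonal_shift[OF \<psi>] by (auto simp: is_resolvent_def w_def)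
    then have "R ((1 / K) *\<^sub>R w) = f \<psi>"
      by (simp only: f_def linear_scale[OF bounded_linear.linear[OF lin]])
    moreover have "norm w \<le> norm (\<mu> \<psi>) + norm z"
      unfolding w_def
      by (rule order.trans[OF norm_triangle_ineq4])
        (simp add: norm_Pair norm_scaleC norm_character \<psi> character_\<Phi>)
    then have "norm w \<le> K" using le by (simp add: K_def)
    then have "norm ((1 / K) *\<^sub>R w) \<le> 1" using K by (simp add: field_simps)
    ultimately show ?thesis by (metis image_eqI mem_cball_0)
  qed
  have "finite (closure (R ` cball 0 1) \<inter> f ` ?A)"
  proof (rule finite_not_islimpt_in_compact)
    show "compact (closure (R ` cball 0 1))" using cpt by (simp add: compact_operator_def)
    show "\<not> x islimpt f ` ?A" for x
    proof (rule discrete_imp_not_islimpt[of "1 / K"])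
      fix u v assume u: "u \<in> f ` ?A" and v: "v \<in> f ` ?A" and d: "dist v u < 1 / K"
      from u obtain \<psi> where \<psi>: "u = f \<psi>" "continuous_character \<psi>" by blast
      from v obtain \<eta> where \<eta>: "v = f \<eta>" "continuous_character \<eta>" by blast
      show "v = u" using sep[OF \<eta>(2) \<psi>(2)] d unfolding \<psi>(1) \<eta>(1) by (simp only:)
    qed (use K in simp)
  qed
  moreover have "f ` ?A \<subseteq> closure (R ` cball 0 1)" using im closure_subset by blast
  ultimately have "finite (f ` ?A)" by (simp add: Int_absorb1)
  moreover have "inj_on f ?A" using sep K by (intro inj_onI) auto
  ultimately show ?thesis by (rule finite_imageD)
qed

text \<open>On \<open>(0, L2_class \<eta>)\<close> the commutator is a difference of multiples of
  the two characters being compared. If they differ, its norm is at least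
  \<open>norm (\<mu> \<eta>)\<close>, so \<open>\<eta>\<close> has weight at most
  \<open>C\<close>.\<close>

lemma almost_equivariant:
  assumes "compact_resolvent (off_diagonal D)"
    and \<psi>: "continuous_character \<psi>"
    and "bounded_commutator (off_diagonal D) (map_prod (gns \<psi>) (gns \<psi>))"
  shows "finite {\<eta>. continuous_character \<eta> \<and> \<Phi> (\<lambda>x. \<psi> x * \<eta> x) \<noteq> (\<lambda>x. \<psi> x * \<Phi> \<eta> x)}"
proof -
  let ?A = "map_prod (gns \<psi>) (gns \<psi>)"
  obtain C where C: "\<And>x y w. (x, y) \<in> off_diagonal D \<Longrightarrow> (?A x, w) \<in> off_diagonal D \<Longrightarrow>
      norm (w - ?A y) \<le> C * norm x"
    using assms(3) unfolding bounded_commutator_def by blast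
  have "norm (\<mu> \<eta>) \<le> C"
    if \<eta>: "continuous_character \<eta>" and ne: "\<Phi> (\<lambda>x. \<psi> x * \<eta> x) \<noteq> (\<lambda>x. \<psi> x * \<Phi> \<eta> x)" for \<eta>
  proof -
    let ?\<psi>\<eta> = "\<lambda>x. \<psi> x * \<eta> x"
    have \<psi>\<eta>: "continuous_character ?\<psi>\<eta>" by (rule continuous_character_mult[OF \<psi> \<eta>])
    have "?A (0, L2_class \<eta>) = (0, L2_class ?\<psi>\<eta>)"
      using gns_character[OF \<psi> \<eta>, of 1] by (simp add: gns_character_zero \<psi> scaleC_one)
    then have "norm ((\<mu> ?\<psi>\<eta> *\<^sub>C L2_class (\<Phi> ?\<psi>\<eta>), 0) - ?A (\<mu> \<eta> *\<^sub>C L2_class (\<Phi> \<eta>), 0)) \<le> C * norm (0 :: 'p L2, L2_class \<eta>)"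
      using off_diagonal_shift[OF \<eta>] off_diagonal_shift[OF \<psi>\<eta>] by (intro C) simp_all
    then have le: "norm (\<mu> ?\<psi>\<eta> *\<^sub>C L2_class (\<Phi> ?\<psi>\<eta>) - \<mu> \<eta> *\<^sub>C L2_class (\<lambda>x. \<psi> x * \<Phi> \<eta> x)) \<le> C"
      by (simp add: gns_character gns_character_zero \<psi> \<eta> character_\<Phi> norm_Pair norm_character)
    have "(norm (\<mu> \<eta>))\<^sup>2 \<le> (norm (\<mu> ?\<psi>\<eta>))\<^sup>2 + (norm (\<mu> \<eta>))\<^sup>2" by simp
    also have "\<dots> = (norm (\<mu> ?\<psi>\<eta> *\<^sub>C L2_class (\<Phi> ?\<psi>\<eta>) - \<mu> \<eta> *\<^sub>C L2_class (\<lambda>x. \<psi> x * \<Phi> \<eta> x)))\<^sup>2"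
      by (rule norm_diff_characters[symmetric]) (auto intro: character_\<Phi> continuous_character_mult \<psi> \<eta> \<psi>\<eta> simp: ne)
    finally have "norm (\<mu> \<eta>) \<le> norm (\<mu> ?\<psi>\<eta> *\<^sub>C L2_class (\<Phi> ?\<psi>\<eta>) - \<mu> \<eta> *\<^sub>C L2_class (\<lambda>x. \<psi> x * \<Phi> \<eta> x))"
      by (rule power2_le_imp_le) simp
    then show ?thesis using le by linarith
  qed
  then show ?thesis
    by (intro finite_subset[OF _ finite_bounded_weights[OF assms(1), of C]]) auto
qed

text \<open>On trigonometric polynomials the values of \<open>D\<close> are combinations of
  characters other than \<open>\<eta>\<close>. Orthogonality to \<open>\<eta>\<close> is a closed
  condition on the graph, so it passes from the core to all of \<open>D\<close>.\<close>

lemma character_in_ker_adjoint: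
  assumes \<eta>: "continuous_character \<eta>" and nim: "\<eta> \<notin> \<Phi> ` {\<psi>. continuous_character \<psi>}"
  shows "L2_class \<eta> \<in> ker (adjoint D)"
proof -
  let ?S = "L2_class ` (trig_poly :: ('p padic_int \<Rightarrow> complex) set)"
  let ?N = "UNIV \<times> {y. cinner y (L2_class \<eta>) = 0} :: ('p L2 \<times> 'p L2) set"
  have "D \<inter> ?S \<times> UNIV \<subseteq> ?N"
  proof
    fix q assume "q \<in> D \<inter> ?S \<times> UNIV"
    then obtain g y where q: "q = (L2_class g, y)" and g: "g \<in> trig_poly" and gy: "(L2_class g, y) \<in> D"
      by auto
    then obtain F c where F: "finite F" "\<forall>\<psi>\<in>F. continuous_character \<psi>"
        "L2_class g = (\<Sum>\<psi>\<in>F. c \<psi> *\<^sub>C L2_class \<psi>)"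
      using trig_poly_class[of "L2_class g"] by blast
    have "(\<Sum>\<psi>\<in>F. c \<psi> *\<^sub>C (L2_class \<psi>, \<mu> \<psi> *\<^sub>C L2_class (\<Phi> \<psi>))) \<in> D"
      using F by (intro complex_vector.subspace_sum complex_vector.subspace_scale subspace shift) auto
    also have "(\<Sum>\<psi>\<in>F. c \<psi> *\<^sub>C (L2_class \<psi>, \<mu> \<psi> *\<^sub>C L2_class (\<Phi> \<psi>))) =
        (L2_class g, \<Sum>\<psi>\<in>F. c \<psi> *\<^sub>C \<mu> \<psi> *\<^sub>C L2_class (\<Phi> \<psi>))"
      by (simp add: F(3) scaleC_prod_def sum_prod)
    finally have "y = (\<Sum>\<psi>\<in>F. c \<psi> *\<^sub>C \<mu> \<psi> *\<^sub>C L2_class (\<Phi> \<psi>))" using gy functional by blast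
    moreover have "cinner (L2_class (\<Phi> \<psi>)) (L2_class \<eta>) = 0" if "\<psi> \<in> F" for \<psi>
    proof -
      have "continuous_character \<psi>" using that F by blast
      moreover from this have "\<Phi> \<psi> \<noteq> \<eta>" using nim by blast
      ultimately show ?thesis by (simp add: cinner_character character_\<Phi> \<eta>)
    qed
    ultimately show "q \<in> ?N"
      by (simp add: q cinner_sum_left cinner_scaleC_left)
  qed
  moreover have "closed ?N" by (intro closed_Times closed_cinner_eq_0) simp
  ultimately have "closure (D \<inter> ?S \<times> UNIV) \<subseteq> ?N" by (rule closure_minimal)
  then have "D \<subseteq> ?N" using core by (simp add: is_core_def)
  then show ?thesis by (auto simp: ker_def adjoint_def)
qed

text \<open>The missing characters form an orthonormal, hence independent, family in a
  finite-dimensional space.\<close>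

lemma finite_coimage:
  assumes "finite_dim (ker (adjoint D))"
  shows "finite ({\<psi>. continuous_character \<psi>} - \<Phi> ` {\<psi>. continuous_character \<psi>})" (is "finite ?A")
proof -
  obtain B where B: "finite B" "ker (adjoint D) \<subseteq> complex_vector.span B"
    using assms by (auto simp: finite_dim_def)
  have "complex_vector.independent (L2_class ` ?A)"
    by (rule orthonormal_independent) (auto simp: cinner_character)
  moreover have "L2_class ` ?A \<subseteq> complex_vector.span B"
    using B(2) character_in_ker_adjoint by blast
  ultimately have "finite (L2_class ` ?A)"
    using complex_vector.independent_span_bound[OF B(1)] by blast
  moreover have "inj_on L2_class ?A"
  proof (rule inj_onI)
    fix \<psi> \<eta> assume "\<psi> \<in> ?A" "\<eta> \<in> ?A" "L2_class \<psi> = L2_class \<eta>"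
    then show "\<psi> = \<eta>"
      using cinner_character[of \<psi> \<eta>] cinner_character[of \<psi> \<psi>] by (simp split: if_splits)
  qed
  ultimately show ?thesis by (rule finite_imageD)
qed

text \<open>A vector in this kernel is orthogonal to every
  \<open>\<mu> \<psi> *\<^sub>C L2_class (\<Phi> \<psi>)\<close>. As the weights are nonzero and
  \<open>\<Phi>\<close> is onto, it is orthogonal to all characters.\<close>

lemma ker_adjoint_trivial:
  assumes dense: "densely_defined D"
    and surj: "\<Phi> ` {\<psi>. continuous_character \<psi>} = {\<psi>. continuous_character \<psi>}"
  shows "ker (adjoint D) = {0}"
proof -
  let ?S = "L2_class ` (trig_poly :: ('p padic_int \<Rightarrow> complex) set)"
  \<comment> \<open>Density of the trigonometric polynomials in \<open>L2\<close> is read off the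
    operator: the core property places the dense domain inside their closure.\<close>
  have "D \<subseteq> closure ?S \<times> UNIV"
    using core closure_mono[of "D \<inter> ?S \<times> UNIV" "?S \<times> UNIV"] by (simp add: is_core_def closure_Times)
  then have "Domain D \<subseteq> closure ?S" by auto
  then have "closure (Domain D) \<subseteq> closure ?S" by (simp add: closure_minimal)
  then have S: "closure ?S = UNIV" using dense by (auto simp: densely_defined_def)
  have "u = 0" if u: "u \<in> ker (adjoint D)" for u
  proof -
    have orth: "cinner (L2_class \<eta>) u = 0" if \<eta>: "continuous_character \<eta>" for \<eta>
    proof -
      obtain \<psi> where \<psi>: "continuous_character \<psi>" "\<eta> = \<Phi> \<psi>" using surj \<eta> by blast
      have "cinner (\<mu> \<psi> *\<^sub>C L2_class (\<Phi> \<psi>)) u = 0"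
        using u shift[OF \<psi>(1)] by (auto simp: ker_def adjoint_def)
      then show ?thesis using weight_nonzero[OF \<psi>(1)] \<psi>(2) by (simp add: cinner_scaleC_left)
    qed
    have "?S \<subseteq> {x. cinner x u = 0}"
    proof
      fix s assume "s \<in> ?S"
      then obtain F c where "finite F" "\<forall>\<psi>\<in>F. continuous_character \<psi>" "s = (\<Sum>\<psi>\<in>F. c \<psi> *\<^sub>C L2_class \<psi>)"
        by (rule trig_poly_class)
      then show "s \<in> {x. cinner x u = 0}" by (simp add: cinner_sum_left cinner_scaleC_left orth)
    qed
    then have "closure ?S \<subseteq> {x. cinner x u = 0}" by (rule closure_minimal[OF _ closed_cinner_eq_0])
    then have "cinner u u = 0" using S by auto
    then show "u = 0" using Re_cinner[of u u] by simp
  qed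
  moreover have "0 \<in> ker (adjoint D)" by (auto simp: ker_def adjoint_def)
  ultimately show ?thesis by blast
qed

lemma fredholm_index_eq_0:
  assumes "compact_resolvent (off_diagonal D)"
    and "\<And>\<psi>. continuous_character \<psi> \<Longrightarrow> bounded_commutator (off_diagonal D) (map_prod (gns \<psi>) (gns \<psi>))"
    and "fredholm D"
  shows "fredholm_index D = 0"
proof -
  let ?G = "char_group :: ('p padic_int \<Rightarrow> complex) monoid"
  interpret group ?G by (rule group_char_group)
  have "\<Phi> ` carrier ?G = carrier ?G"
  proof (rule almost_equivariant_surj)
    show "\<Phi> \<in> carrier ?G \<rightarrow> carrier ?G" by (auto simp: character_\<Phi>)
    show "inj_on \<Phi> (carrier ?G)" using shift_inj by simp
    show "finite (carrier ?G - \<Phi> ` carrier ?G)"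
      using assms(3) finite_coimage by (simp add: fredholm_def)
    show "finite {\<eta> \<in> carrier ?G. \<Phi> (\<psi> \<otimes>\<^bsub>char_group\<^esub> \<eta>) \<noteq> \<psi> \<otimes>\<^bsub>char_group\<^esub> \<Phi> \<eta>}" if "\<psi> \<in> carrier ?G" for \<psi>
      using almost_equivariant[OF assms(1) _ assms(2), of \<psi>] that by simp
    show "\<exists>H. subgroup H ?G \<and> finite H \<and> n < card H" for n
      by (rule char_group_large_finite_subgroup)
  qed
  then have "ker (adjoint D) = {0}"
    using assms(3) by (intro ker_adjoint_trivial) (simp_all add: fredholm_def)
  then show ?thesis by (simp add: fredholm_index_def injective)
qed

end

theorem theorem5p8:
  shows "\<not> (\<exists>(D :: ('p::prime_card L2 \<times> 'p L2) set) (lam :: nat \<Rightarrow> complex) (\<phi> :: nat \<Rightarrow> nat).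
      even_spectral_triple (trig_poly :: ('p padic_int \<Rightarrow> complex) set)
        (\<lambda>f. map_prod (gns f) (gns f)) (off_diagonal D) (\<lambda>(u, v). (u, - v)) \<and>
      is_operator D \<and> is_core (L2_class ` trig_poly) D \<and>
      ker D = {0} \<and> fredholm D \<and> fredholm_index D \<noteq> 0 \<and>
      (\<forall>n. (L2_class (chi n), lam n *\<^sub>C L2_class (chi (\<phi> n))) \<in> D))"
proof (intro notI, elim exE conjE)
  fix D :: "('p L2 \<times> 'p L2) set" and lam :: "nat \<Rightarrow> complex" and \<phi> :: "nat \<Rightarrow> nat"
  assume triple: "even_spectral_triple (trig_poly :: ('p padic_int \<Rightarrow> complex) set)
        (\<lambda>f. map_prod (gns f) (gns f)) (off_diagonal D) (\<lambda>(u, v). (u, - v))"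
    and D: "is_operator D" "is_core (L2_class ` trig_poly) D" "ker D = {0}" "fredholm D"
    and index: "fredholm_index D \<noteq> 0"
    and act: "\<forall>n. (L2_class (chi n), lam n *\<^sub>C L2_class (chi (\<phi> n))) \<in> D"
  \<comment> \<open>An index for each character, available because every continuous character is
    some \<open>chi n\<close>; it carries \<open>lam\<close> and \<open>\<phi>\<close> over to
    characters.\<close>
  let ?i = "inv_into UNIV chi :: ('p padic_int \<Rightarrow> complex) \<Rightarrow> nat"
  have chi_inv: "chi (?i \<psi>) = \<psi>" if "continuous_character \<psi>" for \<psi>
    using that range_chi[where 'p='p] by (metis f_inv_into_f mem_Collect_eq)
  interpret character_shift D "\<lambda>\<psi>. lam (?i \<psi>)" "\<lambda>\<psi>. chi (\<phi> (?i \<psi>))"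
  proof
    fix \<psi> :: "'p padic_int \<Rightarrow> complex" assume "continuous_character \<psi>"
    then show "(L2_class \<psi>, lam (?i \<psi>) *\<^sub>C L2_class (chi (\<phi> (?i \<psi>)))) \<in> D"
      using act chi_inv by metis
  qed (use D chi in auto)
  have "fredholm_index D = 0"
    using triple D(4) by (intro fredholm_index_eq_0) (auto simp: even_spectral_triple_def character_in_trig_poly)
  with index show False by contradiction
qed

end
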